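(* For every Penrose rhombic tiling $\mathcal{T}$ of the plane, with vertex set $V(\mathcal{T})$, there exist infinitely many frieze patterns $f\colon V(\mathcal{T})\to\mathbb{Z}_{>0}$ on $\mathcal{T}$ each of which takes exactly four distinct values.
   Context: Rhombuses. All rhombuses have unit side length (up to an overall similarity). The thick rhombus has interior angles $72^\circ$ and $108^\circ$; the thin rhombus has interior angles $36^\circ$ and $144^\circ$. Penrose rhombic tilings. Identify the plane with $\mathbb{C}$ and let $\zeta=e^{2\pi i/5}$. Let $\gamma_0,\dots,\gamma_4\in\mathbb{R}$ with $\sum_{j=0}^4\gamma_j=0$, and consider the five families of lines $\{z\in\mathbb{C} : \mathrm{Re}(z\zeta^{-j})+\gamma_j=k\}$, $k\in\mathbb{Z}$, $j=0,\dots,4$ (a pentagrid). Assume that no three of these lines meet in a common point (the pentagrid is regular). Put $K_j(z)=\lceil \mathrm{Re}(z\zeta^{-j})+\gamma_j\rceil$. To each intersection point $z_0$ of a line of family $r$ with a line of family $s$ ($r\neq s$) associate the rhombus with the four vertices $\sum_{j=0}^4 K_j(z_0)\zeta^j+\epsilon_1\zeta^r+\epsilon_2\zeta^s$, $\epsilon_1,\epsilon_2\in\{0,1\}$. The collection of all these rhombuses is an edge-to-edge tiling of the plane by thick and thin rhombuses, called the tiling of the regular pentagrid. A Penrose rhombic tiling is (up to similarity) an edge-to-edge tiling of the plane by thick and thin rhombuses each of whose finite patches occurs, up to translation, in the tiling of some regular pentagrid. (All Penrose rhombic tilings are locally indistinguishable.) Frieze pattern. A frieze pattern on a tiling $\mathcal{T}$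 by thick and thin rhombuses is a map $f$ from the set $V(\mathcal{T})$ of vertices of the tiles to the positive integers such that every tile satisfies the diamond rule $bc-ad=1$. Here $a,d$ are the values of $f$ at one pair of opposite vertices and $b,c$ are the values at the other pair, where: for a thick rhombus, $a,d$ are the values at the two $72^\circ$ corners and $b,c$ those at the two $108^\circ$ corners; for a thin rhombus, $a,d$ are the values at the two $144^\circ$ corners and $b,c$ those at the two $36^\circ$ corners. *)

theory Defs
  imports "HOL-Analysis.Analysis"
begin

section \<open>Thick and thin rhombuses\<close>

text \<open>The unsigned angle, in \<open>[0, pi]\<close>, between two nonzero vectors of the plane.\<close>

definition vec_angle :: "complex \<Rightarrow> complex \<Rightarrow> real" where
  "vec_angle u v = arccos (inner u v / (norm u * norm v))"

definition parallelogram :: "complex \<Rightarrow> complex \<Rightarrow> complex \<Rightarrow> complex set" where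
  "parallelogram p u v = convex hull {p, p + u, p + v, p + u + v}"

text \<open>
  \<open>rhombus_sides s \<theta> u v\<close>: for every \<open>p\<close>, the set \<open>parallelogram p u v\<close> is a rhombus of
  side length \<open>s\<close> whose interior angle is \<open>\<theta>\<close> at the opposite corners \<open>p\<close> and
  \<open>p + u + v\<close>, and hence \<open>pi - \<theta>\<close> at the opposite corners \<open>p + u\<close> and \<open>p + v\<close>.
\<close>

definition rhombus_sides :: "real \<Rightarrow> real \<Rightarrow> complex \<Rightarrow> complex \<Rightarrow> bool" where
  "rhombus_sides s \<theta> u v \<longleftrightarrow> 0 < s \<and> norm u = s \<and> norm v = s \<and> vec_angle u v = \<theta>"

text \<open>In both cases the angle prescribed at \<open>p\<close> is the acute one, 72 or 36 degrees.\<close>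

abbreviation thick_sides :: "real \<Rightarrow> complex \<Rightarrow> complex \<Rightarrow> bool" where
  "thick_sides s \<equiv> rhombus_sides s (2 * pi / 5)"

abbreviation thin_sides :: "real \<Rightarrow> complex \<Rightarrow> complex \<Rightarrow> bool" where
  "thin_sides s \<equiv> rhombus_sides s (pi / 5)"

definition thick_rhombus :: "real \<Rightarrow> complex set \<Rightarrow> bool" where
  "thick_rhombus s T \<longleftrightarrow> (\<exists>p u v. thick_sides s u v \<and> T = parallelogram p u v)"

definition thin_rhombus :: "real \<Rightarrow> complex set \<Rightarrow> bool" where
  "thin_rhombus s T \<longleftrightarrow> (\<exists>p u v. thin_sides s u v \<and> T = parallelogram p u v)"


section \<open>Tilings of the plane\<close>

definition plane_tiling :: "complex set set \<Rightarrow> bool" where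
  "plane_tiling \<T> \<longleftrightarrow> \<Union>\<T> = UNIV \<and>
     (\<forall>S\<in>\<T>. \<forall>T\<in>\<T>. S \<noteq> T \<longrightarrow> interior S \<inter> interior T = {})"

text \<open>
  For distinct tiles of a tiling by convex polygons, a common face is the empty set,
  a common vertex, or a full common edge.
\<close>

definition edge_to_edge :: "complex set set \<Rightarrow> bool" where
  "edge_to_edge \<T> \<longleftrightarrow> (\<forall>S\<in>\<T>. \<forall>T\<in>\<T>. (S \<inter> T) face_of S \<and> (S \<inter> T) face_of T)"

definition tiling_vertices :: "complex set set \<Rightarrow> complex set" where
  "tiling_vertices \<T> = {x. \<exists>T\<in>\<T>. x extreme_point_of T}"


section \<open>Pentagrids and Penrose rhombic tilings\<close>

definition zeta :: complex where
  "zeta = exp (2 * of_real pi * \<i> / 5)"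

text \<open>The offsets \<open>\<gamma> 0, \<dots>, \<gamma> 4\<close> are the only values of \<open>\<gamma>\<close> that matter below.\<close>

definition grid_line :: "(nat \<Rightarrow> real) \<Rightarrow> nat \<Rightarrow> int \<Rightarrow> complex set" where
  "grid_line \<gamma> j k = {z. Re (z * zeta powi (- int j)) + \<gamma> j = of_int k}"

definition pentagrid :: "(nat \<Rightarrow> real) \<Rightarrow> complex set set" where
  "pentagrid \<gamma> = {grid_line \<gamma> j k | j k. j < 5}"

definition regular_pentagrid :: "(nat \<Rightarrow> real) \<Rightarrow> bool" where
  "regular_pentagrid \<gamma> \<longleftrightarrow> (\<Sum>j<5. \<gamma> j) = 0 \<and>
     (\<forall>L\<in>pentagrid \<gamma>. \<forall>M\<in>pentagrid \<gamma>. \<forall>N\<in>pentagrid \<gamma>.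
        L \<noteq> M \<and> L \<noteq> N \<and> M \<noteq> N \<longrightarrow> L \<inter> M \<inter> N = {})"

definition grid_index :: "(nat \<Rightarrow> real) \<Rightarrow> nat \<Rightarrow> complex \<Rightarrow> int" where
  "grid_index \<gamma> j z = \<lceil>Re (z * zeta powi (- int j)) + \<gamma> j\<rceil>"

definition pentagrid_tiling :: "(nat \<Rightarrow> real) \<Rightarrow> complex set set" where
  "pentagrid_tiling \<gamma> =
     {parallelogram (\<Sum>j<5. of_int (grid_index \<gamma> j z) * zeta ^ j) (zeta ^ r) (zeta ^ s) | z r s.
        r < 5 \<and> s < 5 \<and> r \<noteq> s \<and> (\<exists>k l. z \<in> grid_line \<gamma> r k \<inter> grid_line \<gamma> s l)}"

text \<open>
  A patch is an arbitrary finite set of tiles; every such set lies in a finite connected one,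
  so requiring connectedness would not change the notion.
\<close>

definition unit_penrose_tiling :: "complex set set \<Rightarrow> bool" where
  "unit_penrose_tiling \<T> \<longleftrightarrow>
     (\<forall>T\<in>\<T>. thick_rhombus 1 T \<or> thin_rhombus 1 T) \<and>
     plane_tiling \<T> \<and> edge_to_edge \<T> \<and>
     (\<forall>P. finite P \<and> P \<subseteq> \<T> \<longrightarrow>
        (\<exists>\<gamma> t. regular_pentagrid \<gamma> \<and> (\<forall>T\<in>P. (\<lambda>z. t + z) ` T \<in> pentagrid_tiling \<gamma>)))"

definition similarity :: "(complex \<Rightarrow> complex) \<Rightarrow> bool" where
  "similarity g \<longleftrightarrow> (\<exists>c>0. \<forall>x y. dist (g x) (g y) = c * dist x y)"

definition penrose_rhombic_tiling :: "complex set set \<Rightarrow> bool" where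
  "penrose_rhombic_tiling \<T> \<longleftrightarrow>
     (\<exists>g \<U>. similarity g \<and> unit_penrose_tiling \<U> \<and> \<T> = (\<lambda>T. g ` T) ` \<U>)"


section \<open>Frieze patterns\<close>

text \<open>
  Patterns are extensional functions (\<open>undefined\<close> off the vertex set), so that distinct
  patterns differ at some vertex. In the diamond rule the 72 degree corners of a thick
  rhombus carry the minus sign, whereas the 36 degree corners of a thin rhombus carry
  the plus sign.
\<close>

definition frieze_pattern :: "complex set set \<Rightarrow> (complex \<Rightarrow> int) \<Rightarrow> bool" where
  "frieze_pattern \<T> f \<longleftrightarrow> f \<in> tiling_vertices \<T> \<rightarrow>\<^sub>E {0<..} \<and>
     (\<forall>s p u v. parallelogram p u v \<in> \<T> \<longrightarrow>
        (thick_sides s u v \<longrightarrow> f (p + u) * f (p + v) - f p * f (p + u + v) = 1) \<and>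
        (thin_sides s u v \<longrightarrow> f p * f (p + u + v) - f (p + u) * f (p + v) = 1))"

end

theory Submission
  imports Defs
begin

text \<open>
  Give the vertex \<open>\<Sum>j<5. K j * zeta ^ j\<close> of the tiling of a regular pentagrid the index
  \<open>\<Sum>j<5. K j\<close> (de Bruijn). At an intersection point of the grid the differences
  \<open>K j - (Re (z * zeta powi (- int j)) + \<gamma> j)\<close> vanish for the two families that meet and lie
  strictly between 0 and 1 for the other three, while the grid coordinates add up to 0; so the
  corner from which the sides \<open>zeta ^ r\<close>, \<open>zeta ^ s\<close> of a tile start has index 1 or 2, the two
  neighbouring corners have one more, and the opposite corner two more. The angle between
  \<open>zeta ^ r\<close> and \<open>zeta ^ s\<close> is 72 or 144 degrees, so the first and the last of these four
  corners are exactly the pair whose product is subtracted in the diamond rule, for thick and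
  for thin tiles alike. Hence, for every \<open>k \<ge> 0\<close>, adding \<open>k\<close> to the index gives a frieze
  pattern, because \<open>(m + 1)\<^sup>2 - m * (m + 2) = 1\<close>; its values lie in \<open>{k + 1, \<dots>, k + 4}\<close>.

  A Penrose tiling need not come from a single pentagrid, so two things remain.

  First, the index must be defined on the whole tiling. The only integral relation between the
  powers of \<open>zeta\<close> is that they add up to 0 (\<open>lattice_point_eq\<close>), so the index modulo 5 of a
  vertex is determined by its position relative to a base vertex, up to the index of the latter.
  If the base vertex is the first corner of a tile, that constant is 1 or 2; if neither value
  suited all tiles, the base tile and two offending tiles would form a patch that occurs in no
  pentagrid tiling (\<open>penrose_levels\<close>).

  Second, all four values must occur, that is, not all tiles may start at the same index. The
  tiles crossed by a walk along parallel copies of a side \<open>zeta ^ r\<close> correspond to the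
  successive intersection points on one grid line of family \<open>r\<close>. From one line of family \<open>r + 1\<close>
  to the next, the coordinate of family \<open>r + 2\<close> advances by the inverse of the golden ratio, and
  with the two families exchanged by the golden ratio itself. The tile starts at index 1 exactly
  when the fractional part lies in a certain interval. If the tiles all started at the same
  index, then in one of the two cases that interval would fit into a half circle, which the
  rotation leaves within two steps (\<open>rotation_leaves_half_circle\<close>). The number of steps that are
  needed is bounded independently of the grid, so a single finite strip of tiles shows that both
  indices occur (\<open>strip_walk_sums_not_constant\<close>, \<open>penrose_strip_changes_level\<close>). The strip
  itself exists because in a locally finite edge-to-edge tiling every edge has a tile on its
  other side (\<open>neighbour_across_edge\<close>).
\<close>

section \<open>Integral combinations of fifth roots of unity\<close>

definition lattice_point :: "(nat \<Rightarrow> int) \<Rightarrow> complex" where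
  "lattice_point n = (\<Sum>j<5. of_int (n j) * zeta ^ j)"

lemma zeta_cis: "zeta = cis (2 * pi / 5)"
  by (simp add: zeta_def cis_conv_exp mult_ac)

lemma norm_zeta_power [simp]: "norm (zeta ^ j) = 1"
  by (simp add: zeta_cis norm_power)

text \<open>
  The angle \<open>x = 2 * pi / 5\<close> satisfies \<open>cos (3 * x) = cos (2 * x)\<close>; dividing the resulting cubic
  equation by \<open>cos x - 1\<close> leaves this quadratic one. It says that \<open>g = 2 * cos x\<close> solves
  \<open>g\<^sup>2 + g = 1\<close>, so that \<open>g\<close> is the inverse of the golden ratio; all later irrationality and
  rotation arguments rest on that.
\<close>

lemma cos72_equation: "4 * (cos (2 * pi / 5))\<^sup>2 + 2 * cos (2 * pi / 5) = 1"
proof -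
  let ?x = "2 * pi / 5"
  have "cos (3 * ?x) = cos (2 * pi - 2 * ?x)"
    by (rule arg_cong[where f=cos]) algebra
  also have "\<dots> = cos (2 * ?x)"
    by (rule cos_2pi_minus)
  finally have "4 * cos ?x ^ 3 - 3 * cos ?x = 2 * (cos ?x)\<^sup>2 - 1"
    unfolding cos_treble_cos cos_double_cos .
  then have "(cos ?x - 1) * (4 * (cos ?x)\<^sup>2 + 2 * cos ?x - 1) = 0"
    by (simp add: algebra_simps power2_eq_square power3_eq_cube)
  moreover have "cos ?x < cos 0"
    by (rule cos_monotone_0_pi) (auto simp: field_simps)
  ultimately show ?thesis by simp
qed

lemma cos72_bounds: "29 / 100 < cos (2 * pi / 5)" "cos (2 * pi / 5) < 33 / 100"
proof -
  let ?c = "cos (2 * pi / 5)"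
  have pos: "0 < ?c" by (rule cos_gt_zero) (auto simp: field_simps)
  have eq: "?c * (4 * ?c + 2) = 1"
    using cos72_equation by (simp add: algebra_simps power2_eq_square)
  show "29 / 100 < ?c"
  proof (rule ccontr)
    assume "\<not> ?thesis"
    then have "?c * (4 * ?c + 2) \<le> (29/100) * (4 * (29/100) + 2)"
      using pos by (intro mult_mono) auto
    then show False using eq by simp
  qed
  show "?c < 33 / 100"
  proof (rule ccontr)
    assume "\<not> ?thesis"
    then have "(33/100) * (4 * (33/100) + 2) \<le> ?c * (4 * ?c + 2)"
      by (intro mult_mono) auto
    then show False using eq by simp
  qed
qed

lemma sin72_bounds: "9 / 10 < sin (2 * pi / 5)" "sin (2 * pi / 5) \<le> 1"
proof -
  let ?c = "cos (2 * pi / 5)" and ?s = "sin (2 * pi / 5)"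
  have "?c * ?c \<le> (33/100) * (33/100)"
    using cos72_bounds by (intro mult_mono) auto
  then have "(9/10)\<^sup>2 < ?s\<^sup>2"
    unfolding sin_squared_eq by (simp add: power2_eq_square)
  moreover have "0 < ?s" by (rule sin_gt_zero) (auto simp: field_simps)
  ultimately show "9 / 10 < ?s"
    by (rule power_less_imp_less_base[OF _ less_imp_le])
qed simp

lemma zeta_powers:
  defines "c \<equiv> cos (2 * pi / 5)" and "s \<equiv> sin (2 * pi / 5)"
  shows "zeta ^ 0 = Complex 1 0" "zeta ^ 1 = Complex c s"
    "zeta ^ 2 = Complex (- c - 1/2) (2 * c * s)"
    "zeta ^ 3 = Complex (- c - 1/2) (- (2 * c * s))"
    "zeta ^ 4 = Complex c (- s)"
proof -
  have c2: "c * c = 1/4 - c / 2"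
    using cos72_equation by (simp add: c_def power2_eq_square)
  have s2: "s * s = 3/4 + c / 2"
    using c2 sin_squared_eq[of "2 * pi / 5"] by (simp add: c_def s_def power2_eq_square)
  have z1: "zeta = Complex c s"
    by (simp add: zeta_cis c_def s_def complex_eq_iff)
  show "zeta ^ 0 = Complex 1 0" by (simp add: complex_eq_iff)
  show "zeta ^ 1 = Complex c s" by (simp add: z1)
  show z2: "zeta ^ 2 = Complex (- c - 1/2) (2 * c * s)"
    by (simp add: power2_eq_square z1 complex_eq_iff c2 s2)
  have ccs: "c * (c * x) = x / 4 - c * x / 2" for x
    unfolding mult.assoc[symmetric] c2 by (simp add: algebra_simps)
  have "c * (s * s) = c / 2 + 1 / 8"
      by (simp add: s2 algebra_simps c2 add_divide_distrib diff_divide_distrib)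
  then have css: "c * (s * (s * x)) = c * x / 2 + x / 8" for x
    by (metis (no_types, lifting) distrib_right mult.assoc mult_1 times_divide_eq_left)
  have e3: "zeta ^ 3 = zeta * zeta ^ 2" by (simp add: power3_eq_cube power2_eq_square)
  show z3: "zeta ^ 3 = Complex (- c - 1/2) (- (2 * c * s))"
    unfolding e3 z2 unfolding z1 by (simp add: complex_eq_iff algebra_simps c2 s2 ccs css)
  have e4: "zeta ^ 4 = zeta * zeta ^ 3" by (simp add: eval_nat_numeral)
  show "zeta ^ 4 = Complex c (- s)"
    unfolding e4 z3 unfolding z1 by (simp add: complex_eq_iff algebra_simps c2 s2 ccs css)
qed

lemma less5_cases:
  assumes "(j::nat) < 5"
  obtains "j = 0" | "j = 1" | "j = 2" | "j = 3" | "j = 4"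
  using assms by linarith

lemma sum5: "(\<Sum>j<5. f j) = f 0 + f 1 + f 2 + f 3 + (f (4::nat) :: 'a :: comm_monoid_add)"
  by (simp add: eval_nat_numeral)

lemma sum_zeta_powers: "(\<Sum>j<5. zeta ^ j) = 0"
  unfolding sum5 zeta_powers by (simp add: complex_eq_iff)

text \<open>
  Both numbers are even by parity, so halving gives an infinite descent. This is the
  irrationality of the golden ratio in integral form.
\<close>

lemma golden_quadratic_form_zero:
  fixes a b :: int
  assumes "a * a = b * b + b * a"
  shows "a = 0 \<and> b = 0"
  using assms
proof (induction "nat (\<bar>a\<bar> + \<bar>b\<bar>)" arbitrary: a b rule: less_induct)
  case less
  have "even (a * a) \<longleftrightarrow> even (b * b + b * a)" using less.prems by simp
  then have "even a" "even b" by auto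
  then obtain a' b' where ab: "a = 2 * a'" "b = 2 * b'" by (elim evenE)
  have "a' * a' = b' * b' + b' * a'" using less.prems by (simp add: ab)
  then have IH: "nat (\<bar>a'\<bar> + \<bar>b'\<bar>) < nat (\<bar>a\<bar> + \<bar>b\<bar>) \<Longrightarrow> a' = 0 \<and> b' = 0"
    using less.hyps by blast
  have "a' = 0 \<and> b' = 0"
  proof (rule ccontr)
    assume "\<not> ?thesis"
    moreover from this have "nat (\<bar>a'\<bar> + \<bar>b'\<bar>) < nat (\<bar>a\<bar> + \<bar>b\<bar>)"
      unfolding ab by linarith
    ultimately show False using IH by blast
  qed
  then show ?case by (simp add: ab)
qed

lemma golden_independent:
  fixes a b :: int
  assumes "of_int a + of_int b * (2 * cos (2 * pi / 5)) = (0::real)"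
  shows "a = 0 \<and> b = 0"
proof -
  let ?g = "2 * cos (2 * pi / 5) :: real"
  have g: "?g * ?g = 1 - ?g"
    using cos72_equation by (simp add: power2_eq_square)
  have a: "of_int a = - (of_int b * ?g)" using assms by linarith
  have "real_of_int (a * a) = of_int (b * b) * (?g * ?g)" by (simp add: a)
  also have "\<dots> = of_int (b * b) - of_int b * (of_int b * ?g)" unfolding g by (simp add: algebra_simps)
  also have "\<dots> = of_int (b * b + b * a)" using a by (simp add: algebra_simps)
  finally have "a * a = b * b + b * a" by (simp only: of_int_eq_iff)
  then show ?thesis by (rule golden_quadratic_form_zero)
qed

text \<open>
  The real part involves only \<open>1\<close> and \<open>g = 2 * cos (2 * pi / 5)\<close>, and after division by
  \<open>sin (2 * pi / 5)\<close> so does the imaginary part; each yields two integral equations because \<open>g\<close>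
  is irrational.
\<close>

lemma lattice_point_eq_0:
  assumes "lattice_point n = 0" and "i < 5" "j < 5"
  shows "n i = n j"
proof -
  let ?c = "cos (2 * pi / 5)" and ?s = "sin (2 * pi / 5)"
  have "Re (lattice_point n) = 0" "Im (lattice_point n) = 0" using assms(1) by auto
  then have re: "of_int (n 0) + (of_int (n 1) + of_int (n 4)) * ?c
      - (of_int (n 2) + of_int (n 3)) * (?c + 1 / 2) = 0"
    and im: "(of_int (n 1) - of_int (n 4)) * ?s + (of_int (n 2) - of_int (n 3)) * (2 * ?c * ?s) = 0"
    unfolding lattice_point_def sum5 zeta_powers by (simp_all add: algebra_simps)
  have "of_int (2 * n 0 - n 2 - n 3) + of_int (n 1 + n 4 - n 2 - n 3) * (2 * ?c) = 0"
    using re by (simp add: algebra_simps)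
  from golden_independent[OF this] have 1: "2 * n 0 = n 2 + n 3" "n 1 + n 4 = n 2 + n 3" by auto
  have "?s * (of_int (n 1 - n 4) + of_int (n 2 - n 3) * (2 * ?c)) = 0"
    using im by (simp add: algebra_simps)
  then have "of_int (n 1 - n 4) + of_int (n 2 - n 3) * (2 * ?c) = 0"
    using sin72_bounds by simp
  from golden_independent[OF this] have "n 1 = n 4" "n 2 = n 3" by auto
  with 1 have "n 0 = n 3" "n 1 = n 3" "n 2 = n 3" "n 4 = n 3" by auto
  then have "n k = n 3" if "k < 5" for k using that by (elim less5_cases) auto
  with assms show ?thesis by metis
qed

lemma lattice_point_eq:
  assumes "lattice_point m = lattice_point n"
  obtains d where "\<And>j. j < 5 \<Longrightarrow> m j = n j + d"
proof -
  have "lattice_point (\<lambda>j. m j - n j) = 0"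
    using assms by (simp add: lattice_point_def algebra_simps sum_subtractf)
  then have "m j - n j = m 0 - n 0" if "j < 5" for j
    using lattice_point_eq_0[of "\<lambda>j. m j - n j" j 0] that by simp
  then show thesis by (intro that[of "m 0 - n 0"]) (simp add: algebra_simps)
qed

text \<open>
  The coefficient sum is therefore well defined modulo 5; this is what makes the index of a
  vertex depend on its position only.
\<close>

lemma lattice_point_eq_sum:
  assumes "lattice_point m = lattice_point n"
  shows "(\<Sum>j<5. m j) mod 5 = (\<Sum>j<5. n j) mod 5"
proof -
  obtain d where "\<And>j. j < 5 \<Longrightarrow> m j = n j + d" using lattice_point_eq[OF assms] by blast
  then have "(\<Sum>j<5. m j) = (\<Sum>j<5. n j) + 5 * d" by (simp add: sum.distrib)
  then show ?thesis by simp
qed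

lemma lattice_point_inj:
  assumes "lattice_point m = lattice_point n" "\<bar>(\<Sum>j<5. m j) - (\<Sum>j<5. n j)\<bar> < 5" "j < 5"
  shows "m j = n j"
proof -
  obtain d where d: "\<And>j. j < 5 \<Longrightarrow> m j = n j + d" using lattice_point_eq[OF assms(1)] by blast
  then have "(\<Sum>j<5. m j) = (\<Sum>j<5. n j) + 5 * d" by (simp add: sum.distrib)
  with assms(2) have "d = 0" by auto
  with d assms(3) show ?thesis by simp
qed

lemma lattice_point_add: "lattice_point (\<lambda>j. m j + n j) = lattice_point m + lattice_point n"
  by (simp add: lattice_point_def sum.distrib algebra_simps)

lemma lattice_point_diff: "lattice_point (\<lambda>j. m j - n j) = lattice_point m - lattice_point n"
  by (simp add: lattice_point_def sum_subtractf algebra_simps)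

lemma lattice_point_unit:
  assumes "r < 5"
  shows "lattice_point (\<lambda>j. if j = r then e else 0) = of_int e * zeta ^ r"
  using assms by (simp add: lattice_point_def if_distrib[of of_int] if_distrib[of
      "\<lambda>x. x * _"] cong: if_cong)

text \<open>
  The signed area of the parallelogram spanned by two vectors. With \<open>u = zeta ^ r\<close>, \<open>cross u z\<close>
  is also the position of \<open>z\<close> along the grid lines of family \<open>r\<close>, and \<open>cross u (zeta ^ j)\<close> is
  the rate at which the grid coordinate of family \<open>j\<close> changes along such a line.
\<close>

definition cross :: "complex \<Rightarrow> complex \<Rightarrow> real" where
  "cross u v = Im (cnj u * v)"

lemma cross_same [simp]: "cross u u = 0"
  by (simp add: cross_def)

lemma cross_zeta_powers:
  assumes "i < 5" "j < 5" "i \<noteq> j"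
  shows "1 / 2 \<le> \<bar>cross (zeta ^ i) (zeta ^ j)\<bar>" "\<bar>cross (zeta ^ i) (zeta ^ j)\<bar> \<le> 1"
proof -
  define c s where cs_def: "c = cos (2 * pi / 5)" "s = sin (2 * pi / 5)"
  let ?k = "cross (zeta ^ i) (zeta ^ j)"
  have cs: "1 / 2 \<le> 2 * c * s" "2 * c * s \<le> 1"
  proof -
    have "(58/100) * (9/10) \<le> (2 * c) * s"
      using cos72_bounds sin72_bounds unfolding cs_def[symmetric] by (intro mult_mono) auto
    then show "1 / 2 \<le> 2 * c * s" by simp
    have "(2 * c) * s \<le> 1 * 1"
      using cos72_bounds sin72_bounds unfolding cs_def[symmetric] by (intro mult_mono) auto
    then show "2 * c * s \<le> 1" by simp
  qed
  have "c * c = 1 / 4 - c / 2" using cos72_equation by (simp add: power2_eq_square cs_def)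
  then have ccs: "c * (c * x) = x / 4 - c * x / 2" for x
    by (metis left_diff_distrib mult.assoc mult_1 times_divide_eq_left)
  have "?k \<in> {s, 2 * c * s, - (2 * c * s), - s}"
    using assms
    by (elim less5_cases) (simp_all only: zeta_powers cross_def cs_def[symmetric], simp_all add:
        algebra_simps ccs)
  then have "\<bar>?k\<bar> = s \<or> \<bar>?k\<bar> = 2 * c * s" using cs sin72_bounds unfolding cs_def[symmetric] by auto
  then show "1 / 2 \<le> \<bar>?k\<bar>" "\<bar>?k\<bar> \<le> 1" using cs sin72_bounds unfolding cs_def[symmetric] by auto
qed

section \<open>Parallelograms and their neighbours in a tiling\<close>

lemma cross_linear: "cross u (v + w) = cross u v + cross u w" "cross u (v - w) = cross u v - cross u w"
  "cross u (of_real a * v) = a * cross u v" "cross (v + w) u = cross v u + cross w u"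
  "cross (v - w) u = cross v u - cross w u"
  "cross (of_real a * v) u = a * cross v u" "cross u (- v) = - cross u v" "cross (- v) u = - cross v u"
  by (simp_all add: cross_def algebra_simps)

lemma cross_le: "\<bar>cross u v\<bar> \<le> norm u * norm v"
  unfolding cross_def using abs_Im_le_cmod[of "cnj u * v"] by (simp add: norm_mult)

lemma cross_coordinates:
  assumes "cross u v \<noteq> 0"
  shows "w = of_real (cross w v / cross u v) * u + of_real (cross u w / cross u v) * v"
proof -
  have "of_real (cross u v) * w = of_real (cross w v) * u + of_real (cross u w) * v"
    by (simp add: cross_def complex_eq_iff algebra_simps)
  then show ?thesis using assms by (simp add: field_simps)
qed

lemma parallelogram_iff:
  "w \<in> parallelogram p u v \<longleftrightarrow>
    (\<exists>a\<in>{0..1}. \<exists>b\<in>{0..1}. w = p + of_real a * u + of_real b * v)"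
proof
  have edge: "x \<in> closed_segment 0 u \<longleftrightarrow> (\<exists>a\<in>{0..1}. x = of_real a * u)" for x u :: complex
    by (auto simp: in_segment scaleR_conv_of_real)
  have "parallelogram p u v = (+) p ` (convex hull ({0, u} + {0, v}))"
    unfolding parallelogram_def convex_hull_translation[symmetric]
    by (rule arg_cong[where f = "(hull) convex"]) (auto simp: set_plus_def algebra_simps)
  then have eq: "parallelogram p u v = (+) p ` (closed_segment 0 u + closed_segment 0 v)"
    by (simp only: convex_hull_set_plus segment_convex_hull)
  show "\<exists>a\<in>{0..1}. \<exists>b\<in>{0..1}. w = p + of_real a * u + of_real b * v" if "w \<in> parallelogram p u v"
  proof -
    from that obtain x y where "x \<in> closed_segment 0 u" "y \<in> closed_segment 0 v" "w = p + x + y"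
      unfolding eq set_plus_def by (auto simp: add.assoc)
    then show ?thesis unfolding edge by blast
  qed
  show "w \<in> parallelogram p u v"
    if "\<exists>a\<in>{0..1}. \<exists>b\<in>{0..1}. w = p + of_real a * u + of_real b * v"
  proof -
    from that obtain a b where ab: "a \<in> {0..1}" "b \<in> {0..1}"
        and w: "w = p + of_real a * u + of_real b * v"
      by blast
    have "of_real a * u \<in> closed_segment 0 u" "of_real b * v \<in> closed_segment 0 v"
      using ab unfolding edge by blast+
    then have "of_real a * u + of_real b * v \<in> closed_segment 0 u + closed_segment 0 v"
      by (rule set_plus_intro)
    then show ?thesis unfolding eq w add.assoc by (rule imageI)
  qed
qed

lemma mem_parallelogram:
  assumes "cross u v \<noteq> 0"
  shows "w \<in> parallelogram p u v \<longleftrightarrow>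
    cross (w - p) v / cross u v \<in> {0..1} \<and> cross u (w - p) / cross u v \<in> {0..1}"
proof
  assume "w \<in> parallelogram p u v"
  then obtain a b where "a \<in> {0..1}" "b \<in> {0..1}" and w: "w = p + of_real a * u + of_real b * v"
    unfolding parallelogram_iff by blast
  moreover have "cross (w - p) v = a * cross u v" "cross u (w - p) = b * cross u v"
    by (simp_all add: w cross_linear)
  ultimately show "cross (w - p) v / cross u v \<in> {0..1} \<and> cross u (w - p) / cross u v \<in> {0..1}"
    using assms by simp
next
  assume "cross (w - p) v / cross u v \<in> {0..1} \<and> cross u (w - p) / cross u v \<in> {0..1}"
  moreover have "w = p + of_real (cross (w - p) v / cross u v) * u
      + of_real (cross u (w - p) / cross u v) * v"
    using cross_coordinates[OF assms, of "w - p"] by (simp add: algebra_simps)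
  ultimately show "w \<in> parallelogram p u v"
    unfolding parallelogram_iff by (intro bexI[where x = "cross (w - p) v / cross u v"]
        bexI[where x = "cross u (w - p) / cross u v"]) simp_all
qed

lemma parallelogram_symmetries:
  "parallelogram p u v = parallelogram p v u"
  "parallelogram p u v = parallelogram (p + v) u (- v)"
  by (simp_all add: parallelogram_def insert_commute add_ac)

lemma translate_parallelogram: "(\<lambda>z. t + z) ` parallelogram p u v = parallelogram (t + p) u v"
  unfolding parallelogram_def convex_hull_translation[symmetric] by (simp add: add.assoc)

text \<open>
  Both coordinates with respect to the sides vanish at the corner and are nonnegative on the
  parallelogram, so they vanish at both ends of any segment that has the corner in its interior.
\<close>

lemma corner_extreme_point:
  assumes "cross u v \<noteq> 0"
  shows "p extreme_point_of parallelogram p u v"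
  unfolding extreme_point_of_def
proof (intro conjI ballI)
  show "p \<in> parallelogram p u v" unfolding mem_parallelogram[OF assms] by (simp add: cross_def)
  fix x y assume xy: "x \<in> parallelogram p u v" "y \<in> parallelogram p u v"
  show "p \<notin> open_segment x y"
  proof
    assume "p \<in> open_segment x y"
    then obtain t where ne: "x \<noteq> y" and t: "0 < t" "t < 1" and p: "p = (1 - t) *\<^sub>R x + t *\<^sub>R y"
      by (auto simp: in_segment)
    let ?l = "\<lambda>w. cross (w - p) v / cross u v" and ?m = "\<lambda>w. cross u (w - p) / cross u v"
    have p0: "(1 - t) *\<^sub>R (x - p) + t *\<^sub>R (y - p) = 0" using p by (simp add: algebra_simps)
    have "cross ((1 - t) *\<^sub>R (x - p) + t *\<^sub>R (y - p)) v = 0"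
        "cross u ((1 - t) *\<^sub>R (x - p) + t *\<^sub>R (y - p)) = 0"
      unfolding p0 by (simp_all add: cross_def)
    then have "(1 - t) * cross (x - p) v + t * cross (y - p) v = 0"
        "(1 - t) * cross u (x - p) + t * cross u (y - p) = 0"
      unfolding scaleR_conv_of_real cross_linear by simp_all
    then have "(1 - t) * ?l x + t * ?l y = 0" "(1 - t) * ?m x + t * ?m y = 0"
      using assms by (simp_all add: field_simps)
    moreover have "0 \<le> ?l x" "0 \<le> ?l y" "0 \<le> ?m x" "0 \<le> ?m y"
      using xy unfolding mem_parallelogram[OF assms] by auto
    moreover have "a = 0 \<and> b = 0" if "(1 - t) * a + t * b = 0" "0 \<le> a" "0 \<le> b" for a b :: real
    proof -
      have "0 \<le> (1 - t) * a" "0 \<le> t * b" using t that by simp_all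
      then have "(1 - t) * a = 0" "t * b = 0" using that(1) by linarith+
      then show ?thesis using t by simp
    qed
    ultimately have "?l x = 0" "?l y = 0" "?m x = 0" "?m y = 0" by blast+
    then have "x - p = 0" "y - p = 0"
      using cross_coordinates[OF assms, of "x - p"] cross_coordinates[OF assms, of "y - p"] assms
          by simp_all
    then show False using ne by simp
  qed
qed

lemma extreme_points_parallelogram:
  assumes "cross u v \<noteq> 0"
  shows "x extreme_point_of parallelogram p u v \<longleftrightarrow> x \<in> {p, p + u, p + v, p + u + v}"
proof
  show "x \<in> {p, p + u, p + v, p + u + v}" if "x extreme_point_of parallelogram p u v"
    using that unfolding parallelogram_def by (rule extreme_point_of_convex_hull)
  have "p + u extreme_point_of parallelogram p u v"
  proof -
    have "parallelogram p u v = parallelogram (p + u) (- u) v"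
      by (simp add: parallelogram_def insert_commute add_ac)
    then show ?thesis using corner_extreme_point[of "- u" v "p + u"] assms by (simp add: cross_linear)
  qed
  moreover have "p + v extreme_point_of parallelogram p u v"
    using corner_extreme_point[of u "- v" "p + v"] assms
        by (simp add: cross_linear flip: parallelogram_symmetries(2))
  moreover have "p + u + v extreme_point_of parallelogram p u v"
  proof -
    have "parallelogram p u v = parallelogram (p + u + v) (- u) (- v)"
      by (simp add: parallelogram_def insert_commute add_ac)
    then show ?thesis using corner_extreme_point[of "- u" "- v" "p + u + v"] assms
        by (simp add: cross_linear)
  qed
  ultimately show "x extreme_point_of parallelogram p u v" if "x \<in> {p, p + u, p + v, p + u + v}"
    using that corner_extreme_point[OF assms] by blast
qed

lemma compact_parallelogram: "compact (parallelogram p u v)"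
  unfolding parallelogram_def by (intro compact_convex_hull finite_imp_compact) simp

text \<open>
  The tiles of a unit Penrose tiling satisfy the hypotheses, so they contain balls of one fixed
  radius.
\<close>

lemma ball_subset_parallelogram:
  assumes "norm u = 1" "norm v = 1" "1 / 2 \<le> \<bar>cross u v\<bar>"
  shows "ball (p + u / 2 + v / 2) (1 / 4) \<subseteq> parallelogram p u v"
proof
  fix w assume "w \<in> ball (p + u / 2 + v / 2) (1 / 4)"
  then have w: "norm (w - (p + u / 2 + v / 2)) < 1 / 4" by (simp add: dist_norm norm_minus_commute)
  define d where "d = w - (p + u / 2 + v / 2)"
  have wp: "w - p = d + of_real (1/2) * u + of_real (1/2) * v" by (simp add: d_def)
  have ne: "cross u v \<noteq> 0" using assms(3) by auto
  have d: "\<bar>cross d v\<bar> < 1 / 4" "\<bar>cross u d\<bar> < 1 / 4"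
    using cross_le[of d v] cross_le[of u d] assms w by (simp_all add: d_def)
  have small: "\<bar>x / cross u v\<bar> \<le> 1 / 2" if "\<bar>x\<bar> < 1 / 4" for x
    using that assms(3) ne by (simp add: abs_divide divide_le_eq)
  have eqs: "cross (w - p) v / cross u v = cross d v / cross u v + 1 / 2"
    "cross u (w - p) / cross u v = cross u d / cross u v + 1 / 2"
    unfolding wp cross_linear using ne by (simp_all add: field_simps)
  show "w \<in> parallelogram p u v"
    unfolding mem_parallelogram[OF ne] eqs atLeastAtMost_iff
    using small[OF d(1)] small[OF d(2)] by (intro conjI; linarith)
qed

lemma parallelogram_dist_le:
  assumes "x \<in> parallelogram p u v" "norm u = 1" "norm v = 1"
  shows "dist x p \<le> 2"
proof -
  obtain a b where ab: "a \<in> {0..1}" "b \<in> {0..1}" and x: "x = p + of_real a * u + of_real b * v"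
    using assms(1) unfolding parallelogram_iff by blast
  have "dist x p = norm (of_real a * u + of_real b * v)" by (simp add: x dist_norm)
  also have "\<dots> \<le> norm (of_real a * u) + norm (of_real b * v)" by (rule norm_triangle_ineq)
  also have "\<dots> \<le> 2" using ab assms by (simp add: norm_mult)
  finally show ?thesis .
qed

text \<open>
  The balls inside distinct tiles have centres at distance at least \<open>\<rho>\<close>, and the centres that
  belong to tiles near \<open>m\<close> lie in a compact set; infinitely many of them would accumulate.
\<close>

lemma locally_finite_if_fat_tiles:
  fixes \<T> :: "'a :: euclidean_space set set"
  assumes disj: "\<And>S T. S \<in> \<T> \<Longrightarrow> T \<in> \<T> \<Longrightarrow> S \<noteq> T \<Longrightarrow> interior S \<inter> interior T = {}"
    and fat: "\<And>T. T \<in> \<T> \<Longrightarrow> \<exists>c. ball c \<rho> \<subseteq> T \<and> T \<subseteq> cball c R" and \<rho>: "0 < \<rho>"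
  shows "finite {T \<in> \<T>. T \<inter> ball m r \<noteq> {}}"
proof (rule ccontr)
  let ?F = "{T \<in> \<T>. T \<inter> ball m r \<noteq> {}}"
  assume inf: "infinite ?F"
  have "\<forall>T\<in>\<T>. \<exists>c. ball c \<rho> \<subseteq> T \<and> T \<subseteq> cball c R" using fat by simp
  from bchoice[OF this] obtain c where "\<forall>T\<in>\<T>. ball (c T) \<rho> \<subseteq> T \<and> T \<subseteq> cball (c T) R" ..
  then have c: "ball (c T) \<rho> \<subseteq> T \<and> T \<subseteq> cball (c T) R" if "T \<in> \<T>" for T using that by simp
  have far: "\<rho> \<le> dist (c S) (c T)" if "S \<in> \<T>" "T \<in> \<T>" "S \<noteq> T" for S T
  proof (rule ccontr)
    assume "\<not> ?thesis"
    then have "c T \<in> ball (c S) \<rho>" "c T \<in> ball (c T) \<rho>" using \<rho> by auto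
    moreover have "ball (c S) \<rho> \<subseteq> interior S" "ball (c T) \<rho> \<subseteq> interior T"
      using c[OF that(1)] c[OF that(2)] by (simp_all add: interior_maximal)
    ultimately have "c T \<in> interior S" "c T \<in> interior T" by auto
    then show False using disj[OF that] by blast
  qed
  have "inj_on c ?F" using far \<rho> by (force simp: inj_on_def)
  then have "infinite (c ` ?F)" using inf finite_imageD by blast
  moreover have "c ` ?F \<subseteq> cball m (R + r)"
  proof
    fix y assume "y \<in> c ` ?F"
    then obtain T x where T: "T \<in> \<T>" "y = c T" "x \<in> T" "x \<in> ball m r" by blast
    then have "dist (c T) x \<le> R" using c[OF T(1)] by auto
    then show "y \<in> cball m (R + r)" using T(2,4) dist_triangle[of m "c T" x] by (simp add: dist_commute)
  qed
  ultimately obtain l where l: "l islimpt c ` ?F"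
    using compact_cball[of m "R + r"] unfolding compact_eq_Bolzano_Weierstrass by blast
  have lim: "\<exists>x\<in>c ` ?F. x \<noteq> l \<and> dist x l < e" if "0 < e" for e
    using l that unfolding islimpt_approachable by blast
  from lim[of "\<rho> / 2"] \<rho> obtain y where y: "y \<in> c ` ?F" "y \<noteq> l" "dist y l < \<rho> / 2" by auto
  from lim[of "min (\<rho> / 2) (dist y l)"] \<rho> y obtain x where
    x: "x \<in> c ` ?F" "dist x l < \<rho> / 2" "dist x l < dist y l" by auto
  have "x \<noteq> y" using x by auto
  then have "\<rho> \<le> dist x y" using far x(1) y(1) by blast
  moreover have "dist x y < \<rho>" using x y dist_triangle2[of x y l] by simp
  ultimately show False by simp
qed

text \<open>
  Points just outside the midpoint of the edge lie in finitely many other tiles, one of which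
  contains the midpoint since tiles are closed. It meets the given tile in a common face, and a
  face that contains an inner point of an edge contains both its ends.
\<close>

lemma neighbour_across_edge:
  assumes tiling: "plane_tiling \<T>" "edge_to_edge \<T>"
    and tiles: "\<And>T. T \<in> \<T> \<Longrightarrow> \<exists>p u v. norm u = 1 \<and> norm v = 1 \<and> 1 / 2 \<le> \<bar>cross u v\<bar> \<and>
        T = parallelogram p u v"
    and T: "parallelogram p u v \<in> \<T>" and ne: "cross u v \<noteq> 0"
  obtains S where "S \<in> \<T>" "S \<noteq> parallelogram p u v" "p extreme_point_of S" "p + u extreme_point_of S"
proof -
  let ?T = "parallelogram p u v"
  define m where "m = p + of_real (1/2) * u"
  have disj: "S \<noteq> T \<Longrightarrow> interior S \<inter> interior T = {}" if "S \<in> \<T>" "T \<in> \<T>" for S T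
    using tiling(1) that by (auto simp: plane_tiling_def)
  \<comment> \<open>The radius exceeds the distance from \<open>m\<close> to the points outside the edge that are used below.\<close>
  define F where "F = {S \<in> \<T>. S \<inter> ball m (norm v + 1) \<noteq> {}} - {?T}"
  have "finite {S \<in> \<T>. S \<inter> ball m (norm v + 1) \<noteq> {}}"
  proof (rule locally_finite_if_fat_tiles[OF disj])
    fix T assume "T \<in> \<T>"
    then obtain p u v where T: "norm u = 1" "norm v = 1" "1 / 2 \<le> \<bar>cross u v\<bar>" "T = parallelogram p u v"
      using tiles by blast
    have "dist x (p + u / 2 + v / 2) \<le> 3" if "x \<in> T" for x
    proof -
      have "norm (u / 2 + v / 2) \<le> 1"
        using T norm_triangle_ineq[of "u / 2" "v / 2"] by (simp add: norm_divide)
      moreover have "dist (p + u / 2 + v / 2) p = norm (u / 2 + v / 2)" by (simp add: dist_norm add.assoc)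
      moreover have "dist x p \<le> 2" using parallelogram_dist_le[OF _ T(1,2), of x p] that T(4) by simp
      ultimately show ?thesis using dist_triangle2[of x "p + u / 2 + v / 2" p] by linarith
    qed
    then have "T \<subseteq> cball (p + u / 2 + v / 2) 3" by (auto simp: dist_commute)
    then show "\<exists>c. ball c (1/4) \<subseteq> T \<and> T \<subseteq> cball c 3"
      using ball_subset_parallelogram[OF T(1-3)] T(4) by blast
  qed simp_all
  then have "finite F" by (simp add: F_def)
  have closed: "closed (\<Union>F)"
  proof (rule closed_Union[OF \<open>finite F\<close>])
    show "\<forall>S\<in>F. closed S"
    proof
      fix S assume "S \<in> F"
      then have "S \<in> \<T>" by (simp add: F_def)
      then obtain p u v where "S = parallelogram p u v" using tiles by blast
      then show "closed S" using compact_imp_closed[OF compact_parallelogram] by simp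
    qed
  qed
  have outside: "m - of_real \<delta> * v \<in> \<Union>F" if \<delta>: "0 < \<delta>" "\<delta> \<le> 1" for \<delta>
  proof -
    let ?w = "m - of_real \<delta> * v"
    have "?w \<in> \<Union>\<T>" using tiling(1) by (simp add: plane_tiling_def)
    then obtain S where S: "S \<in> \<T>" "?w \<in> S" ..
    have wp: "?w - p = of_real (1/2) * u - of_real \<delta> * v" by (simp add: m_def)
    have "cross u (?w - p) / cross u v = - \<delta>"
      unfolding wp cross_linear cross_same using ne by simp
    then have "?w \<notin> ?T" unfolding mem_parallelogram[OF ne] using \<delta> by simp
    then have "S \<noteq> ?T" using S by blast
    have "\<delta> * norm v \<le> norm v" using \<delta> by (simp add: mult_left_le_one_le)
    then have "?w \<in> ball m (norm v + 1)" using \<delta> by (simp add: dist_norm norm_mult)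
    then have "S \<in> F" using S \<open>S \<noteq> ?T\<close> unfolding F_def by blast
    then show ?thesis using S by blast
  qed
  have lim: "(\<lambda>n. m - of_real (inverse (of_nat (Suc n))) * v) \<longlonglongrightarrow> m - of_real 0 * v"
    by (intro tendsto_intros LIMSEQ_inverse_real_of_nat)
  have "m - of_real (inverse (of_nat (Suc n))) * v \<in> \<Union>F" for n
    by (rule outside) (simp_all add: inverse_le_1_iff del: of_nat_Suc)
  from closed_sequentially[OF closed this lim] have "m \<in> \<Union>F" by simp
  then obtain S where S: "S \<in> \<T>" "S \<noteq> ?T" "m \<in> S" by (auto simp: F_def)
  have face: "(S \<inter> ?T) face_of S" "(S \<inter> ?T) face_of ?T"
    using tiling(2) S(1) T by (auto simp: edge_to_edge_def)
  have ends: "p extreme_point_of ?T" "p + u extreme_point_of ?T"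
    using extreme_points_parallelogram[OF ne] by blast+
  have "u \<noteq> 0" using ne by (auto simp: cross_def)
  then have seg: "m \<in> open_segment p (p + u)"
    unfolding in_segment m_def by (auto intro!: exI[of _ "1/2"] simp: algebra_simps scaleR_conv_of_real)
  have pT: "p \<in> ?T" "p + u \<in> ?T" using ends by (auto simp: extreme_point_of_def)
  have "convex ?T" by (simp add: parallelogram_def)
  then have "open_segment p (p + u) \<subseteq> ?T" using pT unfolding convex_contains_open_segment by blast
  then have "m \<in> S \<inter> ?T" using seg S(3) by blast
  from face_ofD[OF face(2) seg pT this] have in_S: "p \<in> S \<inter> ?T" "p + u \<in> S \<inter> ?T" by simp_all
  have "x extreme_point_of S" if "x \<in> S \<inter> ?T" "x extreme_point_of ?T" for x
  proof -
    have "{x} face_of ?T" using that by (simp add: face_of_singleton)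
    then have "{x} face_of (S \<inter> ?T)" by (rule face_of_subset) (use that in auto)
    from face_of_trans[OF this face(1)] have "{x} face_of S" .
    then show ?thesis by (simp add: face_of_singleton)
  qed
  then show thesis using that[OF S(1,2)] in_S ends by blast
qed

section \<open>Intersection points of a regular pentagrid\<close>

abbreviation grid_corner :: "(nat \<Rightarrow> real) \<Rightarrow> complex \<Rightarrow> complex" where
  "grid_corner \<gamma> z \<equiv> lattice_point (\<lambda>j. grid_index \<gamma> j z)"

abbreviation zeta_tile :: "complex \<Rightarrow> nat \<Rightarrow> nat \<Rightarrow> complex set" where
  "zeta_tile p r s \<equiv> parallelogram p (zeta ^ r) (zeta ^ s)"

text \<open>
  The lines of family \<open>j\<close> are the level sets of this function at the integers, and \<open>grid_index\<close>
  is its ceiling.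
\<close>

definition grid_coord :: "(nat \<Rightarrow> real) \<Rightarrow> nat \<Rightarrow> complex \<Rightarrow> real" where
  "grid_coord \<gamma> j z = inner z (zeta ^ j) + \<gamma> j"

lemma Re_times_zeta_power: "Re (z * zeta powi (- int j)) = inner z (zeta ^ j)"
proof -
  have "zeta powi (- int j) = cnj (zeta ^ j)"
    by (simp add: zeta_cis power_int_minus cis_cnj power_inverse flip: cis_inverse)
  then show ?thesis by (simp add: inner_complex_def del: complex_cnj_power)
qed

lemma grid_index_eq: "grid_index \<gamma> j z = \<lceil>grid_coord \<gamma> j z\<rceil>"
  by (simp only: grid_index_def grid_coord_def Re_times_zeta_power)

lemma mem_grid_line: "z \<in> grid_line \<gamma> j k \<longleftrightarrow> grid_coord \<gamma> j z = of_int k"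
  by (simp only: grid_line_def grid_coord_def Re_times_zeta_power mem_Collect_eq)

lemma inner_cross_decomposition:
  assumes "norm u = 1"
  shows "inner w v = inner w u * inner u v + cross u w * cross u v"
proof -
  have "(Re u)\<^sup>2 + (Im u)\<^sup>2 = 1" using assms by (simp add: cmod_def)
  then have "inner w v = ((Re u)\<^sup>2 + (Im u)\<^sup>2) * inner w v" by simp
  then show ?thesis
    by (simp add: inner_complex_def cross_def algebra_simps power2_eq_square)
qed

lemma grid_coord_along_line:
  assumes "grid_coord \<gamma> r z = grid_coord \<gamma> r w"
  shows "grid_coord \<gamma> j w
    = grid_coord \<gamma> j z + (cross (zeta ^ r) w - cross (zeta ^ r) z) * cross (zeta ^ r) (zeta ^ j)"
proof -
  have "inner (w - z) (zeta ^ j) = inner (w - z) (zeta ^ r) * inner (zeta ^ r) (zeta ^ j)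
      + cross (zeta ^ r) (w - z) * cross (zeta ^ r) (zeta ^ j)"
    by (rule inner_cross_decomposition) simp
  moreover have "inner (w - z) (zeta ^ r) = 0"
    using assms by (simp add: grid_coord_def inner_diff_left)
  moreover have "cross (zeta ^ r) (w - z) = cross (zeta ^ r) w - cross (zeta ^ r) z"
    by (simp add: cross_def algebra_simps)
  ultimately show ?thesis by (simp add: grid_coord_def inner_diff_left)
qed

lemma eq_if_same_line_and_position:
  assumes "grid_coord \<gamma> r z = grid_coord \<gamma> r w" "cross (zeta ^ r) w = cross (zeta ^ r) z"
  shows "w = z"
proof -
  have "inner (w - z) (w - z) = inner (w - z) (zeta ^ r) * inner (zeta ^ r) (w - z)
      + cross (zeta ^ r) (w - z) * cross (zeta ^ r) (w - z)"
    by (rule inner_cross_decomposition) simp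
  moreover have "inner (w - z) (zeta ^ r) = 0"
    using assms by (simp add: grid_coord_def inner_diff_left)
  moreover have "cross (zeta ^ r) (w - z) = 0"
    using assms by (simp add: cross_def algebra_simps)
  ultimately show ?thesis by simp
qed

lemma exists_point_on_line:
  obtains w where "grid_coord \<gamma> r w = grid_coord \<gamma> r z" "cross (zeta ^ r) w = cross (zeta ^ r) z + t"
proof -
  define u where "u = zeta ^ r"
  have n: "(Re u)\<^sup>2 + (Im u)\<^sup>2 = 1"
    using norm_zeta_power[of r] unfolding u_def[symmetric] by (simp add: cmod_def)
  let ?w = "z + of_real t * \<i> * u"
  have "grid_coord \<gamma> r ?w = grid_coord \<gamma> r z"
    unfolding grid_coord_def u_def[symmetric] by (simp add: inner_add_left) (simp add: inner_complex_def)
  moreover have "cross u ?w = cross u z + t * ((Re u)\<^sup>2 + (Im u)\<^sup>2)"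
    by (simp add: cross_def algebra_simps power2_eq_square)
  ultimately show thesis using n by (intro that[of ?w]) (simp_all flip: u_def)
qed

text \<open>
  The fifth roots of unity and the offsets both add up to 0.
\<close>

lemma sum_grid_coord:
  assumes "regular_pentagrid \<gamma>"
  shows "(\<Sum>j<5. grid_coord \<gamma> j z) = 0"
proof -
  have "(\<Sum>j<5. grid_coord \<gamma> j z) = inner z (\<Sum>j<5. zeta ^ j) + (\<Sum>j<5. \<gamma> j)"
    by (simp add: grid_coord_def sum.distrib inner_sum_right)
  also have "\<dots> = 0" using assms by (simp add: sum_zeta_powers regular_pentagrid_def)
  finally show ?thesis .
qed

definition crossing :: "(nat \<Rightarrow> real) \<Rightarrow> complex \<Rightarrow> nat \<Rightarrow> nat \<Rightarrow> bool" where
  "crossing \<gamma> z r s \<longleftrightarrow> r < 5 \<and> s < 5 \<and> r \<noteq> s \<and> grid_coord \<gamma> r z \<in> \<int> \<and> grid_coord \<gamma> s z \<in> \<int>"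

lemma crossing_sym: "crossing \<gamma> z r s \<Longrightarrow> crossing \<gamma> z s r"
  by (auto simp: crossing_def)

lemma pentagrid_tiling_iff:
  "T \<in> pentagrid_tiling \<gamma> \<longleftrightarrow>
    (\<exists>z r s. crossing \<gamma> z r s \<and> T = zeta_tile (grid_corner \<gamma> z) r s)"
  unfolding pentagrid_tiling_def crossing_def Ints_def lattice_point_def
  by (fastforce simp: mem_grid_line)

lemma grid_lines_distinct:
  assumes "i < 5" "j < 5" "i \<noteq> j" "z \<in> grid_line \<gamma> i k"
  shows "grid_line \<gamma> i k \<noteq> grid_line \<gamma> j l"
proof
  assume eq: "grid_line \<gamma> i k = grid_line \<gamma> j l"
  obtain w where w: "grid_coord \<gamma> i w = grid_coord \<gamma> i z" "cross (zeta ^ i) w = cross (zeta ^ i) z + 1"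
    by (rule exists_point_on_line)
  have "w \<in> grid_line \<gamma> i k" using assms w by (simp add: mem_grid_line)
  then have "grid_coord \<gamma> j w = grid_coord \<gamma> j z"
    using assms(4) eq by (simp add: mem_grid_line)
  then have "cross (zeta ^ i) (zeta ^ j) = 0"
    using grid_coord_along_line[of \<gamma> i z w j] w by simp
  then show False using cross_zeta_powers(1)[OF assms(1-3)] by simp
qed

text \<open>
  Regularity: an integral coordinate of a third family would put three grid lines through one
  point.
\<close>

lemma crossing_not_Ints:
  assumes reg: "regular_pentagrid \<gamma>" and cr: "crossing \<gamma> z r s" and j: "j < 5" "j \<noteq> r" "j \<noteq> s"
  shows "grid_coord \<gamma> j z \<notin> \<int>"
proof
  assume "grid_coord \<gamma> j z \<in> \<int>"
  then obtain m where m: "z \<in> grid_line \<gamma> j m" by (auto simp: mem_grid_line Ints_def)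
  obtain k l where kl: "z \<in> grid_line \<gamma> r k" "z \<in> grid_line \<gamma> s l"
    using cr by (auto simp: mem_grid_line Ints_def crossing_def)
  have rs: "r < 5" "s < 5" "r \<noteq> s" using cr by (auto simp: crossing_def)
  have "grid_line \<gamma> r k \<in> pentagrid \<gamma>" "grid_line \<gamma> s l \<in> pentagrid \<gamma>" "grid_line \<gamma> j m \<in> pentagrid \<gamma>"
    using rs j by (auto simp: pentagrid_def)
  moreover have "grid_line \<gamma> r k \<noteq> grid_line \<gamma> s l" "grid_line \<gamma> r k \<noteq> grid_line \<gamma> j m"
    "grid_line \<gamma> s l \<noteq> grid_line \<gamma> j m"
    using grid_lines_distinct rs j kl by metis+
  ultimately have "grid_line \<gamma> r k \<inter> grid_line \<gamma> s l \<inter> grid_line \<gamma> j m = {}"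
    using reg unfolding regular_pentagrid_def by blast
  then show False using m kl by blast
qed

text \<open>
  The coordinates add up to 0, so the sum of the ceilings is the sum of their distances to the
  coordinates. Two of these are 0 and the other three lie strictly between 0 and 1.
\<close>

lemma sum_grid_index_crossing:
  assumes reg: "regular_pentagrid \<gamma>" and cr: "crossing \<gamma> z r s"
  shows "(\<Sum>j<5. grid_index \<gamma> j z) \<in> {1, 2}"
proof -
  let ?l = "\<lambda>j. of_int (grid_index \<gamma> j z) - grid_coord \<gamma> j z"
  have rs: "r < 5" "s < 5" "r \<noteq> s" using cr by (auto simp: crossing_def)
  have l: "?l r = 0" "?l s = 0" using cr by (auto simp: crossing_def grid_index_eq Ints_def)
  have pos: "0 < ?l j \<and> ?l j < 1" if "j \<in> {..<5} - {r, s}" for j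
  proof -
    have "grid_coord \<gamma> j z \<notin> \<int>" using crossing_not_Ints[OF reg cr] that by auto
    then have "of_int (grid_index \<gamma> j z) \<noteq> grid_coord \<gamma> j z" by (metis Ints_of_int)
    then show ?thesis unfolding grid_index_eq by linarith
  qed
  have c3: "card ({..<5} - {r, s}) = 3" using rs by (simp add: card_Diff_subset)
  have ne: "{..<5} - {r, s} \<noteq> {}"
  proof
    assume "{..<5} - {r, s} = {}"
    then show False using c3 by (metis card.empty zero_neq_numeral)
  qed
  have "real_of_int (\<Sum>j<5. grid_index \<gamma> j z) = (\<Sum>j<5. ?l j)"
    using sum_grid_coord[OF reg, of z] by (simp add: sum_subtractf)
  also have "\<dots> = (\<Sum>j\<in>{..<5} - {r, s}. ?l j)"
    using l by (intro sum.mono_neutral_right) auto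
  finally have eq: "real_of_int (\<Sum>j<5. grid_index \<gamma> j z) = (\<Sum>j\<in>{..<5} - {r, s}. ?l j)" .
  have "0 < (\<Sum>j\<in>{..<5} - {r, s}. ?l j)"
    using pos ne by (intro sum_pos) auto
  moreover have "(\<Sum>j\<in>{..<5} - {r, s}. ?l j) < (\<Sum>j\<in>{..<5} - {r, s}. 1)"
    using pos ne by (intro sum_strict_mono) auto
  ultimately have "0 < real_of_int (\<Sum>j<5. grid_index \<gamma> j z)" "real_of_int (\<Sum>j<5. grid_index \<gamma> j z) < 3"
    unfolding eq using c3 by simp_all
  then have "0 < (\<Sum>j<5. grid_index \<gamma> j z)" "(\<Sum>j<5. grid_index \<gamma> j z) < 3"
    by (simp_all only: of_int_0_less_iff of_int_less_numeral_iff)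
  then show ?thesis by auto
qed

text \<open>
  Suppose that the fractional parts stay in a half circle. As \<open>g\<close> lies between 1/2 and 3/4, each
  of the two steps then lowers the integral part by exactly one, so after both steps the
  fractional part has changed by \<open>2 - 2 * g\<close>, which is more than a half circle.
\<close>

lemma rotation_leaves_half_circle:
  fixes y g :: real
  assumes "1/2 < g" "g < 3/4"
    and "\<bar>frac y - frac (y - g)\<bar> \<le> 1/2" "\<bar>frac (y - g) - frac (y - 2 * g)\<bar> \<le> 1/2"
      "\<bar>frac y - frac (y - 2 * g)\<bar> \<le> 1/2"
  shows False
proof -
  let ?d = "\<lfloor>y\<rfloor> - \<lfloor>y - g\<rfloor>" and ?e = "\<lfloor>y - g\<rfloor> - \<lfloor>y - 2 * g\<rfloor>"
  have d: "of_int ?d = g + (frac (y - g) - frac y)"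
      and e: "of_int ?e = g + (frac (y - 2 * g) - frac (y - g))"
    by (simp_all add: frac_def)
  have "0 < real_of_int ?d" "real_of_int ?d < 2" unfolding d using assms by linarith+
  then have "?d = 1" by linarith
  moreover have "0 < real_of_int ?e" "real_of_int ?e < 2" unfolding e using assms by linarith+
  then have "?e = 1" by linarith
  ultimately have "frac y - frac (y - 2 * g) = 2 * g - 2"
    using d e by simp
  then show False using assms by linarith
qed

text \<open>
  The coordinates of the other four families along a grid line of family \<open>r\<close>, whose own
  coordinate is \<open>k\<close>: families \<open>r + 1\<close>, \<open>r + 4\<close> move with speeds \<open>s\<close>, \<open>- s\<close>, families \<open>r + 2\<close>,
  \<open>r + 3\<close> with speeds \<open>g * s\<close>, \<open>- g * s\<close>. The coordinates of families \<open>r + 1\<close> and \<open>r + 4\<close>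
  therefore add up to \<open>ca + cd\<close> all along the line. At a crossing with family \<open>r + 1\<close> this fixes
  the fractional part contributed by family \<open>r + 4\<close>, so a prescribed sum \<open>\<sigma>\<close> of ceilings
  confines the fractional part of family \<open>r + 2\<close> to an interval whose length is \<open>\<alpha>\<close> or \<open>\<beta>\<close>;
  likewise with \<open>r + 1\<close> and \<open>r + 2\<close> exchanged, and then the other length applies. As
  \<open>\<alpha> + \<beta> = 1\<close>, one of the two intervals fits into a half circle, and three consecutive crossings
  of that kind contradict the rotation lemma.
\<close>

lemma strip_sums_not_constant:
  fixes s g ca cb cc cd :: real and k \<sigma> :: int
  assumes g: "1/2 < g" "g < 3/4" "g * g + g = 1" and s: "1/2 \<le> g * s"
    and sum0: "k + ca + cb + cc + cd = 0"
    and ni: "\<And>t. ca + s * t \<in> \<int> \<Longrightarrow> cd - s * t \<notin> \<int>"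
    and \<sigma>: "\<sigma> = 1 \<or> \<sigma> = 2"
    and const: "\<And>t. 0 \<le> t \<Longrightarrow> t \<le> 6 \<Longrightarrow> ca + s * t \<in> \<int> \<or> cb + g * s * t \<in> \<int> \<Longrightarrow>
      k + \<lceil>ca + s * t\<rceil> + \<lceil>cb + g * s * t\<rceil> + \<lceil>cc - g * s * t\<rceil> + \<lceil>cd - s * t\<rceil> = \<sigma>"
  shows False
proof -
  have spos: "0 < s"
  proof (rule ccontr)
    assume "\<not> 0 < s"
    then have "g * s \<le> 0" using g by (intro mult_nonneg_nonpos) auto
    then show False using s by simp
  qed
  have s2: "1 / 2 \<le> s"
  proof -
    have "g * s \<le> 1 * s" using g spos by (intro mult_right_mono) auto
    then show ?thesis using s by simp
  qed
  define \<alpha> \<beta> where "\<alpha> = frac (ca + cd)" and "\<beta> = frac (- (ca + cd))"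
  have \<alpha>\<beta>: "\<alpha> + \<beta> = 1"
  proof -
    have "ca + cd \<notin> \<int>" using ni[of "- ca / s"] spos by (simp add: add.commute)
    then show ?thesis unfolding \<alpha>_def \<beta>_def by (simp only: frac_neg if_False)
  qed
  have ceil: "real_of_int \<lceil>x\<rceil> = x + frac (- x)" for x :: real
    by (simp add: frac_def ceiling_def)
  have const': "frac (- (ca + s * t)) + frac (- (cb + g * s * t)) + frac (- (cc - g * s * t))
      + frac (- (cd - s * t)) = of_int \<sigma>"
    if "0 \<le> t" "t \<le> 6" "ca + s * t \<in> \<int> \<or> cb + g * s * t \<in> \<int>" for t
  proof -
    have "real_of_int \<sigma>
        = real_of_int (k + \<lceil>ca + s * t\<rceil> + \<lceil>cb + g * s * t\<rceil> + \<lceil>cc - g * s * t\<rceil> + \<lceil>cd - s * t\<rceil>)"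
      using const[OF that] by simp
    then show ?thesis using sum0 unfolding of_int_add ceil by linarith
  qed
  have fr: "0 \<le> frac x \<and> frac x < 1" for x :: real by (simp add: frac_lt_1)
  have A: "frac (- (cb + g * s * t)) + frac (- (cc - g * s * t)) = of_int \<sigma> - \<beta>"
    if t: "0 \<le> t" "t \<le> 6" "ca + s * t \<in> \<int>" for t
  proof -
    obtain n where n: "ca + s * t = of_int n" using t(3) by (rule Ints_cases)
    have "- (cd - s * t) = - (ca + cd) + of_int n" using n by simp
    then have "frac (- (cd - s * t)) = \<beta>" unfolding \<beta>_def by (simp only: frac_add_of_int_right)
    moreover have "frac (- (ca + s * t)) = 0" unfolding n by simp
    ultimately show ?thesis using const'[OF t(1,2) disjI1[OF t(3)]] by linarith
  qed
  have B: "frac (- (ca + s * t)) + frac (- (cd - s * t)) = of_int \<sigma> - \<alpha>"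
    if t: "0 \<le> t" "t \<le> 6" "cb + g * s * t \<in> \<int>" for t
  proof -
    obtain n where n: "cb + g * s * t = of_int n" using t(3) by (rule Ints_cases)
    have "- (cc - g * s * t) = (ca + cd) + of_int (k + n)" using n sum0 by simp
    then have "frac (- (cc - g * s * t)) = \<alpha>" unfolding \<alpha>_def by (simp only: frac_add_of_int_right)
    moreover have "frac (- (cb + g * s * t)) = 0" unfolding n by simp
    ultimately show ?thesis using const'[OF t(1,2) disjI2[OF t(3)]] by linarith
  qed
  have rotation: False
    if H: "\<And>i. i \<in> {0, 1, 2} \<Longrightarrow>
      frac (y - i * g) \<le> 1/2 \<and> \<sigma> = 1 \<or> 1/2 \<le> frac (y - i * g) \<and> \<sigma> = 2" for y
  proof -
    have diff: "\<bar>frac (y - i * g) - frac (y - j * g)\<bar> \<le> 1/2" if "i \<in> {0, 1, 2}" "j \<in> {0, 1, 2}" for i j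
      using H[OF that(1)] H[OF that(2)] fr[of "y - i * g"] fr[of "y - j * g"] by linarith
    show False
      using rotation_leaves_half_circle[of g y] g diff[of 0 1] diff[of 1 2] diff[of 0 2] by simp
  qed
  consider (a) "\<alpha> \<le> 1/2 \<and> \<sigma> = 1 \<or> \<beta> \<le> 1/2 \<and> \<sigma> = 2" | (b) "\<beta> \<le> 1/2 \<and> \<sigma> = 1 \<or> \<alpha> \<le> 1/2 \<and> \<sigma> = 2"
    using \<alpha>\<beta> \<sigma> by linarith
  then show False
  proof cases
    case a
    \<comment> \<open>the parameters of successive crossings with family \<open>r + 1\<close>\<close>
    define t where "t = (\<lambda>i. (of_int \<lceil>ca\<rceil> + i - ca) / s)"
    have st: "s * t i = of_int \<lceil>ca\<rceil> + i - ca" for i using spos by (simp add: t_def)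
    have gst: "g * s * t i = g * (of_int \<lceil>ca\<rceil> + i - ca)" for i using st[of i] by (simp add: mult.assoc)
    define y where "y = - (cb + g * s * t 0)"
    have y: "- (cb + g * s * t i) = y - i * g" for i unfolding y_def gst by (simp add: algebra_simps)
    have "frac (y - i * g) \<le> 1/2 \<and> \<sigma> = 1 \<or> 1/2 \<le> frac (y - i * g) \<and> \<sigma> = 2" if "i \<in> {0, 1, 2}" for i
    proof -
      have "ca + s * t i \<in> \<int>" using that by (auto simp: st)
      moreover have "0 \<le> t i" "t i \<le> 6"
      proof -
        have num: "0 \<le> of_int \<lceil>ca\<rceil> + i - ca" "of_int \<lceil>ca\<rceil> + i - ca \<le> 3"
          using that by (auto, linarith+)
        then show "0 \<le> t i" unfolding t_def using spos by simp
        have "of_int \<lceil>ca\<rceil> + i - ca \<le> 6 * s" using num s2 by linarith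
        then show "t i \<le> 6" unfolding t_def using spos by (simp add: divide_le_eq)
      qed
      ultimately have "frac (y - i * g) + frac (- (cc - g * s * t i)) = of_int \<sigma> - \<beta>"
        using A[of "t i"] y[of i] by simp
      then show ?thesis using a fr[of "- (cc - g * s * t i)"] \<alpha>\<beta>
        by (elim disjE conjE) (simp_all only: of_int_1 of_int_numeral, linarith+)
    qed
    then show False by (rule rotation)
  next
    case b
    \<comment> \<open>Crossings with family \<open>r + 2\<close>: in between, family \<open>r + 1\<close> advances by \<open>1 / g = 1 + g\<close>,
      which is a rotation by \<open>g\<close> as well.\<close>
    define t where "t = (\<lambda>i. (of_int \<lceil>cb\<rceil> + i - cb) / (g * s))"
    have gst: "g * s * t i = of_int \<lceil>cb\<rceil> + i - cb" for i using spos g by (simp add: t_def)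
    have "(1 + g) * g = 1" using g by (simp add: algebra_simps)
    then have st: "s * t i = (1 + g) * (of_int \<lceil>cb\<rceil> + i - cb)" for i
      unfolding gst[symmetric] mult.assoc[symmetric] by simp
    define y where "y = - (ca + s * t 0)"
    have y: "- (ca + s * t i) = y - i * g - i" for i unfolding y_def st by (simp add: algebra_simps)
    have "frac (y - i * g) \<le> 1/2 \<and> \<sigma> = 1 \<or> 1/2 \<le> frac (y - i * g) \<and> \<sigma> = 2" if "i \<in> {0, 1, 2}" for i
    proof -
      have "cb + g * s * t i \<in> \<int>" using that by (auto simp: gst)
      moreover have "0 \<le> t i" "t i \<le> 6"
      proof -
        have num: "0 \<le> of_int \<lceil>cb\<rceil> + i - cb" "of_int \<lceil>cb\<rceil> + i - cb \<le> 3"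
          using that by (auto, linarith+)
        then show "0 \<le> t i" unfolding t_def using spos g by simp
        have "of_int \<lceil>cb\<rceil> + i - cb \<le> 6 * (g * s)" using num s by linarith
        then show "t i \<le> 6" unfolding t_def using spos g by (simp add: divide_le_eq)
      qed
      ultimately have "frac (y - i * g - i) + frac (- (cd - s * t i)) = of_int \<sigma> - \<alpha>"
        using B[of "t i"] y[of i] by simp
      moreover obtain n :: int where n: "i = of_int n" using \<open>i \<in> _\<close>
          by (auto intro: that[of 0] that[of 1] that[of 2])
      have "frac (y - i * g - i) = frac (y - i * g)"
        using frac_add_of_int_right[of "y - i * g" "- n"] n by simp
      ultimately show ?thesis using b fr[of "- (cd - s * t i)"] \<alpha>\<beta>
        by (elim disjE conjE) (simp_all only: of_int_1 of_int_numeral, linarith+)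
    qed
    then show False by (rule rotation)
  qed
qed

section \<open>Walking along a grid line\<close>

lemma cross_zeta_shift:
  fixes r :: nat
  assumes "r < 5"
  defines "c \<equiv> cos (2 * pi / 5)" and "s \<equiv> sin (2 * pi / 5)"
  shows "cross (zeta ^ r) (zeta ^ ((r + 1) mod 5)) = s"
      "cross (zeta ^ r) (zeta ^ ((r + 2) mod 5)) = 2 * c * s"
    "cross (zeta ^ r) (zeta ^ ((r + 3) mod 5)) = - (2 * c * s)"
        "cross (zeta ^ r) (zeta ^ ((r + 4) mod 5)) = - s"
proof -
  have cross_add: "cross (zeta ^ (m + i)) (zeta ^ (m + j)) = cross (zeta ^ i) (zeta ^ j)" for m i j
  proof -
    have "cnj (zeta ^ m) * zeta ^ m = 1"
      by (metis complex_norm_square mult.commute norm_zeta_power of_real_1 power_one)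
    moreover have "cnj (zeta ^ (m + i)) * zeta ^ (m + j)
      = cnj (zeta ^ m) * zeta ^ m * (cnj (zeta ^ i) * zeta ^ j)"
      by (simp only: power_add complex_cnj_mult mult_ac)
    ultimately have "cnj (zeta ^ (m + i)) * zeta ^ (m + j) = cnj (zeta ^ i) * zeta ^ j"
      by (simp only: mult_1)
    then show ?thesis by (simp add: cross_def)
  qed
  have z5: "zeta ^ (m mod 5) = zeta ^ m" for m
  proof -
    have "zeta ^ 5 = 1" using Complex.DeMoivre[of "2 * pi / 5" 5] by (simp add: zeta_cis)
    then have "zeta ^ (5 * (m div 5) + m mod 5) = zeta ^ (m mod 5)"
        by (simp only: power_add power_mult power_one mult_1)
    then show ?thesis by simp
  qed
  have "cross (zeta ^ r) (zeta ^ ((r + j) mod 5)) = Im (zeta ^ j)" for j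
    using cross_add[of r 0 j] by (simp add: z5 cross_def)
  then show "cross (zeta ^ r) (zeta ^ ((r + 1) mod 5)) = s"
      "cross (zeta ^ r) (zeta ^ ((r + 2) mod 5)) = 2 * c * s"
    "cross (zeta ^ r) (zeta ^ ((r + 3) mod 5)) = - (2 * c * s)"
        "cross (zeta ^ r) (zeta ^ ((r + 4) mod 5)) = - s"
    unfolding c_def s_def by (simp_all only: zeta_powers complex.sel)
qed

lemma sum5_shift:
  fixes f :: "nat \<Rightarrow> 'a :: comm_monoid_add"
  assumes "r < 5"
  shows "(\<Sum>j<5. f j)
      = f r + f ((r + 1) mod 5) + f ((r + 2) mod 5) + f ((r + 3) mod 5) + f ((r + 4) mod 5)"
  using assms by (elim less5_cases) (simp_all add: sum5 ac_simps numeral_2_eq_2)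

text \<open>
  A segment of length 6 on a grid line contains three consecutive crossings with each of the
  families \<open>r + 1\<close> and \<open>r + 2\<close>, as the coordinates of these families change at rate at least
  1/2.
\<close>

lemma grid_line_segment_sums_not_constant:
  assumes reg: "regular_pentagrid \<gamma>" and r: "r < 5" and z0: "grid_coord \<gamma> r z0 \<in> \<int>" and \<sigma>: "\<sigma> \<in> {1, 2}"
  obtains (witness) z s where "crossing \<gamma> z r s" "grid_coord \<gamma> r z = grid_coord \<gamma> r z0"
    "cross (zeta ^ r) z0 \<le> cross (zeta ^ r) z" "cross (zeta ^ r) z \<le> cross (zeta ^ r) z0 + 6"
    "(\<Sum>j<5. grid_index \<gamma> j z) \<noteq> \<sigma>"
proof (rule ccontr)
  assume not_thesis: "\<not> thesis"
  have const: "(\<Sum>j<5. grid_index \<gamma> j z) = \<sigma>"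
    if "crossing \<gamma> z r s" "grid_coord \<gamma> r z = grid_coord \<gamma> r z0"
    "cross (zeta ^ r) z0 \<le> cross (zeta ^ r) z" "cross (zeta ^ r) z \<le> cross (zeta ^ r) z0 + 6" for z s
    using witness that not_thesis by blast
  define c s where cs: "c = cos (2 * pi / 5)" "s = sin (2 * pi / 5)"
  define h where "h = (\<lambda>i. (r + i) mod 5)"
  have h: "h 1 = (r + 1) mod 5" "h 2 = (r + 2) mod 5" "h 3 = (r + 3) mod 5" "h 4 = (r + 4) mod 5"
    by (simp_all add: h_def)
  have j5: "h i < 5" for i by (simp add: h_def)
  have dist: "h 1 \<noteq> r" "h 2 \<noteq> r" "h 4 \<noteq> r" "h 4 \<noteq> h 1"
    using r unfolding h_def by presburger+
  obtain k where k: "grid_coord \<gamma> r z0 = of_int k" using z0 by (auto simp: Ints_def)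
  have "\<forall>t. \<exists>w. grid_coord \<gamma> r w = grid_coord \<gamma> r z0 \<and> cross (zeta ^ r) w = cross (zeta ^ r) z0 + t"
    by (metis exists_point_on_line)
  then obtain P where P: "\<And>t. grid_coord \<gamma> r (P t) = grid_coord \<gamma> r z0"
    "\<And>t. cross (zeta ^ r) (P t) = cross (zeta ^ r) z0 + t" by metis
  have coord: "grid_coord \<gamma> j (P t) = grid_coord \<gamma> j z0 + t * cross (zeta ^ r) (zeta ^ j)" for j t
    using grid_coord_along_line[OF P(1)[symmetric], of j t] P(2)[of t] by simp
  note coords = cross_zeta_shift[OF r, folded cs, folded h]
  have c1: "grid_coord \<gamma> (h 1) (P t) = grid_coord \<gamma> (h 1) z0 + s * t"
    and c2: "grid_coord \<gamma> (h 2) (P t) = grid_coord \<gamma> (h 2) z0 + 2 * c * s * t"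
    and c3: "grid_coord \<gamma> (h 3) (P t) = grid_coord \<gamma> (h 3) z0 - 2 * c * s * t"
    and c4: "grid_coord \<gamma> (h 4) (P t) = grid_coord \<gamma> (h 4) z0 - s * t" for t
    unfolding coord coords by simp_all
  show False
  proof (rule strip_sums_not_constant[where s = s and g = "2 * c" and k = k and \<sigma> = \<sigma>
        and ca = "grid_coord \<gamma> (h 1) z0" and cb = "grid_coord \<gamma> (h 2) z0"
        and cc = "grid_coord \<gamma> (h 3) z0" and cd = "grid_coord \<gamma> (h 4) z0"])
    show "1 / 2 < 2 * c" "2 * c < 3 / 4" using cos72_bounds by (simp_all add: cs)
    show "2 * c * (2 * c) + 2 * c = 1" using cos72_equation by (simp add: cs power2_eq_square)
    have "1 / 2 \<le> \<bar>2 * c * s\<bar>" using cross_zeta_powers(1)[OF r j5 dist(2)[symmetric]] unfolding coords .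
    moreover have "0 < 2 * c * s" using cos72_bounds sin72_bounds by (simp add: cs)
    ultimately show "1 / 2 \<le> 2 * c * s" by simp
    show "k + grid_coord \<gamma> (h 1) z0 + grid_coord \<gamma> (h 2) z0 + grid_coord \<gamma> (h 3) z0
        + grid_coord \<gamma> (h 4) z0 = 0"
      using sum_grid_coord[OF reg, of z0] unfolding sum5_shift[OF r, folded h] k by simp
    show "\<sigma> = 1 \<or> \<sigma> = 2" using \<sigma> by simp
  next
    fix t
    assume "grid_coord \<gamma> (h 1) z0 + s * t \<in> \<int>"
    then have "crossing \<gamma> (P t) r (h 1)"
      using r dist P(1)[of t] z0 c1[of t] by (simp add: crossing_def j5)
    from crossing_not_Ints[OF reg this j5 dist(3) dist(4)]
    show "grid_coord \<gamma> (h 4) z0 - s * t \<notin> \<int>" unfolding c4 .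
  next
    fix t :: real
    assume t: "0 \<le> t" "t \<le> 6"
        and "grid_coord \<gamma> (h 1) z0 + s * t \<in> \<int> \<or> grid_coord \<gamma> (h 2) z0 + 2 * c * s * t \<in> \<int>"
    then have "crossing \<gamma> (P t) r (h 1) \<or> crossing \<gamma> (P t) r (h 2)"
      using r dist P(1)[of t] z0 c1[of t] c2[of t] by (simp add: crossing_def j5)
    then have "(\<Sum>j<5. grid_index \<gamma> j (P t)) = \<sigma>"
      using const[OF _ P(1)[of t]] P(2)[of t] t by auto
    then show "k + \<lceil>grid_coord \<gamma> (h 1) z0 + s * t\<rceil> + \<lceil>grid_coord \<gamma> (h 2) z0 + 2 * c * s * t\<rceil>
      + \<lceil>grid_coord \<gamma> (h 3) z0 - 2 * c * s * t\<rceil> + \<lceil>grid_coord \<gamma> (h 4) z0 - s * t\<rceil> = \<sigma>"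
      by (simp only: sum5_shift[OF r, folded h] grid_index_eq c1 c2 c3 c4 P(1) k ceiling_of_int)
  qed
qed

text \<open>
  A tile with sides \<open>zeta ^ r\<close> and \<open>zeta ^ s\<close> has two sides parallel to \<open>zeta ^ r\<close>; the one that
  is met last when moving along the grid line of family \<open>r\<close> in its positive direction starts at
  \<open>ahead r s\<close> times \<open>zeta ^ s\<close> from the first corner of the tile.
\<close>

definition ahead :: "nat \<Rightarrow> nat \<Rightarrow> int" where
  "ahead r j = (if 0 < cross (zeta ^ r) (zeta ^ j) then 1 else 0)"

lemma lattice_point_add_unit:
  assumes "s < 5"
  shows "lattice_point (\<lambda>j. n j + (if j = s then e else 0)) = lattice_point n + of_int e * zeta ^ s"
  unfolding lattice_point_add lattice_point_unit[OF assms] ..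

text \<open>
  Two tiles that share a side parallel to \<open>zeta ^ r\<close> come from consecutive intersection points
  on one grid line of family \<open>r\<close>. Indeed the common side determines the vector \<open>M\<close> of grid
  indices on an open segment of that line, and both intersection points have coordinates within
  the closed unit intervals below \<open>M\<close>; a point strictly between them has no integral coordinate
  besides that of family \<open>r\<close>. The last claim counts the steps: with signs given by the direction
  of motion, each crossing raises the sum of the indices by one.
\<close>

lemma strip_step:
  fixes e :: int
  assumes reg: "regular_pentagrid \<gamma>" and cr: "crossing \<gamma> z r s" and cr': "crossing \<gamma> z' r s'"
    and e: "e \<in> {0, 1}" and ne: "z' \<noteq> z"
    and edge: "grid_corner \<gamma> z' + of_int e * zeta ^ s'
      = grid_corner \<gamma> z + of_int (ahead r s) * zeta ^ s"
  shows "grid_coord \<gamma> r z' = grid_coord \<gamma> r z"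
    and "\<And>w t. crossing \<gamma> w r t \<Longrightarrow> grid_coord \<gamma> r w = grid_coord \<gamma> r z \<Longrightarrow>
      cross (zeta ^ r) z < cross (zeta ^ r) w \<Longrightarrow> cross (zeta ^ r) z' \<le> cross (zeta ^ r) w"
    and "(\<Sum>j<5. sgn (cross (zeta ^ r) (zeta ^ j)) * of_int (grid_index \<gamma> j z'
        + (if j = s' then ahead r s' else 0)))
      = (\<Sum>j<5. sgn (cross (zeta ^ r) (zeta ^ j)) * of_int (grid_index \<gamma> j z + (if j = s then ahead r s
          else 0))) + 1"
proof -
  define M where "M = (\<lambda>j. grid_index \<gamma> j z + (if j = s then ahead r s else 0))"
  have ahead01: "ahead r j \<in> {0, 1}" for j by (simp add: ahead_def)
  have rs: "r < 5" "s < 5" "r \<noteq> s" "s' < 5" "r \<noteq> s'" using cr cr' by (auto simp: crossing_def)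
  have sumM: "(\<Sum>j<5. n j + (if j = i then x else 0)) = (\<Sum>j<5. n j) + x" if "i < 5" for n and i :: nat
      and x :: int
    using that by (simp add: sum.distrib)
  \<comment> \<open>Both index sums are at most 3, hence too close to differ by a nonzero multiple of 5.\<close>
  have M': "M j = grid_index \<gamma> j z' + (if j = s' then e else 0)" if "j < 5" for j
    unfolding M_def
  proof (rule lattice_point_inj[OF _ _ that])
    show "lattice_point (\<lambda>j. grid_index \<gamma> j z + (if j = s then ahead r s else 0))
      = lattice_point (\<lambda>j. grid_index \<gamma> j z' + (if j = s' then e else 0))"
      unfolding lattice_point_add_unit[OF rs(2)] lattice_point_add_unit[OF rs(4)] edge ..
    show "\<bar>(\<Sum>j<5. grid_index \<gamma> j z + (if j = s then ahead r s else 0))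
      - (\<Sum>j<5. grid_index \<gamma> j z' + (if j = s' then e else 0))\<bar> < 5"
      unfolding sumM[OF rs(2)] sumM[OF rs(4)]
      using sum_grid_index_crossing[OF reg cr] sum_grid_index_crossing[OF reg cr'] e ahead01[of s] by auto
  qed
  let ?x = "\<lambda>j. grid_coord \<gamma> j z" and ?x' = "\<lambda>j. grid_coord \<gamma> j z'"
  have int: "of_int (grid_index \<gamma> r z) = ?x r" "of_int (grid_index \<gamma> s z) = ?x s"
    "of_int (grid_index \<gamma> r z') = ?x' r" "of_int (grid_index \<gamma> s' z') = ?x' s'"
    using cr cr' by (auto simp: crossing_def grid_index_eq Ints_def)
  have "grid_index \<gamma> r z' = grid_index \<gamma> r z" using M'[of r] rs by (simp add: M_def)
  then show line: "?x' r = ?x r" using int by simp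
  have ceil: "of_int \<lceil>x\<rceil> - 1 \<le> x \<and> x \<le> of_int \<lceil>x\<rceil>" for x :: real by linarith
  have Mz: "of_int (M j) - 1 \<le> ?x j \<and> ?x j \<le> of_int (M j)" for j
    using ceil[of "?x j"] int(2) ahead01[of s] by (auto simp: M_def grid_index_eq)
  have Mz': "of_int (M j) - 1 \<le> ?x' j \<and> ?x' j \<le> of_int (M j)" if "j < 5" for j
    using ceil[of "?x' j"] int(4) e by (auto simp: M'[OF that] grid_index_eq)
  define \<tau> where "\<tau> = cross (zeta ^ r) z' - cross (zeta ^ r) z"
  have x': "?x' j = ?x j + \<tau> * cross (zeta ^ r) (zeta ^ j)" for j
    unfolding \<tau>_def using line by (intro grid_coord_along_line) simp
  have cross_ne: "cross (zeta ^ r) (zeta ^ j) \<noteq> 0" if "j < 5" "j \<noteq> r" for j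
    using cross_zeta_powers(1)[of r j] that rs(1) by auto
  have "\<tau> \<noteq> 0" using ne eq_if_same_line_and_position[OF line[symmetric]] by (auto simp: \<tau>_def)
  moreover have "0 \<le> \<tau>"
  proof (cases "0 < cross (zeta ^ r) (zeta ^ s)")
    case True
    then have "?x s = of_int (M s) - 1" using int(2) by (simp add: M_def ahead_def)
    then have "0 \<le> \<tau> * cross (zeta ^ r) (zeta ^ s)" using Mz'[OF rs(2)] x'[of s] by linarith
    then show ?thesis using True by (simp add: zero_le_mult_iff)
  next
    case False
    then have "?x s = of_int (M s)" using int(2) by (simp add: M_def ahead_def)
    then have "\<tau> * cross (zeta ^ r) (zeta ^ s) \<le> 0" using Mz'[OF rs(2)] x'[of s] by linarith
    then show ?thesis using False cross_ne[of s] rs by (auto simp: mult_le_0_iff)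
  qed
  ultimately have \<tau>: "0 < \<tau>" by simp
  show "cross (zeta ^ r) z' \<le> cross (zeta ^ r) w"
    if w: "crossing \<gamma> w r t" "grid_coord \<gamma> r w = ?x r" "cross (zeta ^ r) z < cross (zeta ^ r) w" for w t
  proof (rule ccontr)
    define \<omega> where "\<omega> = cross (zeta ^ r) w - cross (zeta ^ r) z"
    assume "\<not> ?thesis"
    then have \<omega>: "0 < \<omega>" "\<omega> < \<tau>" using w(3) by (simp_all add: \<omega>_def \<tau>_def)
    have t: "t < 5" "t \<noteq> r" using w(1) by (auto simp: crossing_def)
    have xw: "grid_coord \<gamma> t w = ?x t + \<omega> * cross (zeta ^ r) (zeta ^ t)"
      unfolding \<omega>_def using w(2) by (intro grid_coord_along_line) simp
    obtain n where n: "grid_coord \<gamma> t w = of_int n" using w(1) by (auto simp: crossing_def Ints_def)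
    have "?x t < of_int n \<and> of_int n < ?x' t \<or> ?x' t < of_int n \<and> of_int n < ?x t"
      unfolding n[symmetric] xw x' using \<omega> cross_ne[OF t]
      by (cases "0 < cross (zeta ^ r) (zeta ^ t)") (auto simp: mult_less_0_iff zero_less_mult_iff)
    then have "of_int (M t) - 1 < real_of_int n" "real_of_int n < of_int (M t)"
      using Mz[of t] Mz'[OF t(1)] by auto
    then have "real_of_int (M t) < of_int (n + 1)" by simp
    then have "M t < n + 1" by (simp only: of_int_less_iff)
    moreover have "n < M t" using \<open>real_of_int n < of_int (M t)\<close> by (simp only: of_int_less_iff)
    ultimately show False by simp
  qed
  \<comment> \<open>The second tile is entered through the common side, so that side is the one opposite to its side ahead.\<close>
  have e_eq: "e = 1 - ahead r s'"
  proof (cases "0 < cross (zeta ^ r) (zeta ^ s')")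
    case True
    then have "0 < \<tau> * cross (zeta ^ r) (zeta ^ s')" using \<tau> by simp
    then have "of_int (M s') - 1 < ?x' s'" using Mz[of s'] x'[of s'] by linarith
    then have "e < 1" using int(4) M'[OF rs(4)] by simp
    then show ?thesis using True e by (simp add: ahead_def)
  next
    case False
    then have "\<tau> * cross (zeta ^ r) (zeta ^ s') < 0" using \<tau> cross_ne[of s'] rs
        by (simp add: mult_less_0_iff)
    then have "?x' s' < of_int (M s')" using Mz[of s'] x'[of s'] by linarith
    then have "0 < e" using int(4) M'[OF rs(4)] by simp
    then show ?thesis using False e by (simp add: ahead_def)
  qed
  let ?sg = "\<lambda>j. sgn (cross (zeta ^ r) (zeta ^ j))"
  have "?sg j * of_int (grid_index \<gamma> j z' + (if j = s' then ahead r s' else 0))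
    = ?sg j * of_int (M j) + (if j = s' then 1 else 0)" if "j < 5" for j
    using M'[OF that] e_eq cross_ne[of s'] rs by (auto simp: ahead_def sgn_if algebra_simps)
  then have "(\<Sum>j<5. ?sg j * of_int (grid_index \<gamma> j z' + (if j = s' then ahead r s' else 0)))
    = (\<Sum>j<5. ?sg j * of_int (M j) + (if j = s' then 1 else 0))"
    by (intro sum.cong) auto
  also have "\<dots> = (\<Sum>j<5. ?sg j * of_int (M j)) + 1"
    using rs by (simp add: sum.distrib)
  finally show "(\<Sum>j<5. ?sg j * of_int (grid_index \<gamma> j z' + (if j = s' then ahead r s' else 0)))
      = (\<Sum>j<5. ?sg j * of_int (grid_index \<gamma> j z + (if j = s then ahead r s else 0))) + 1"
    unfolding M_def .
qed

text \<open>
  The signed index sum grows by one with each step but stays within 5 of the signed sum of the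
  coordinates, which grows at rate at most 5 along the line. Forty steps therefore cover a
  length of at least \<open>(40 - 10) / 5 = 6\<close>, and every crossing on that segment is visited.
\<close>

lemma strip_walk_sums_not_constant:
  fixes z :: "nat \<Rightarrow> complex" and s :: "nat \<Rightarrow> nat"
  assumes reg: "regular_pentagrid \<gamma>"
    and cr: "\<And>i. i \<le> 40 \<Longrightarrow> crossing \<gamma> (z i) r (s i)"
    and ne: "\<And>i. i < 40 \<Longrightarrow> z (Suc i) \<noteq> z i"
    and edge: "\<And>i. i < 40 \<Longrightarrow> \<exists>e\<in>{0, 1}. grid_corner \<gamma> (z (Suc i)) + of_int e * zeta ^ s (Suc i)
      = grid_corner \<gamma> (z i) + of_int (ahead r (s i)) * zeta ^ s i"
  shows "\<exists>i\<le>40. (\<Sum>j<5. grid_index \<gamma> j (z i)) \<noteq> (\<Sum>j<5. grid_index \<gamma> j (z 0))"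
proof -
  let ?p = "cross (zeta ^ r)" and ?sg = "\<lambda>j. sgn (cross (zeta ^ r) (zeta ^ j))"
  let ?\<Phi> = "\<lambda>i. \<Sum>j<5. ?sg j * of_int (grid_index \<gamma> j (z i) + (if j = s i then ahead r (s i) else 0))"
  have r: "r < 5" using cr[of 0] by (simp add: crossing_def)
  have step: "grid_coord \<gamma> r (z (Suc i)) = grid_coord \<gamma> r (z i)"
    "\<And>w t. crossing \<gamma> w r t \<Longrightarrow> grid_coord \<gamma> r w = grid_coord \<gamma> r (z i) \<Longrightarrow> ?p (z i) < ?p w \<Longrightarrow>
        ?p (z (Suc i)) \<le> ?p w"
    "?\<Phi> (Suc i) = ?\<Phi> i + 1" if i: "i < 40" for i
  proof -
    from edge[OF i] obtain e :: int where e: "e \<in> {0, 1}"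
        and eq: "grid_corner \<gamma> (z (Suc i)) + of_int e * zeta ^ s (Suc i)
      = grid_corner \<gamma> (z i) + of_int (ahead r (s i)) * zeta ^ s i" by blast
    have "crossing \<gamma> (z i) r (s i)" "crossing \<gamma> (z (Suc i)) r (s (Suc i))" using cr i by auto
    note S = strip_step[OF reg this e ne[OF i] eq]
    show "grid_coord \<gamma> r (z (Suc i)) = grid_coord \<gamma> r (z i)" by (rule S(1))
    show "?p (z (Suc i)) \<le> ?p w"
        if "crossing \<gamma> w r t" "grid_coord \<gamma> r w = grid_coord \<gamma> r (z i)" "?p (z i) < ?p w" for w t
      using S(2) that .
    show "?\<Phi> (Suc i) = ?\<Phi> i + 1" by (rule S(3))
  qed
  have line: "grid_coord \<gamma> r (z i) = grid_coord \<gamma> r (z 0)" if "i \<le> 40" for i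
    using that by (induction i) (simp_all add: step(1))
  have \<Phi>: "?\<Phi> i = ?\<Phi> 0 + of_nat i" if "i \<le> 40" for i
    using that
  proof (induction i)
    case (Suc i)
    then show ?case using step(3)[of i] by simp
  qed simp
  have \<Phi>_bound: "\<bar>?\<Phi> i - (\<Sum>j<5. ?sg j * grid_coord \<gamma> j (z i))\<bar> \<le> 5" if "i \<le> 40" for i
  proof -
    have "\<bar>?sg j * of_int (grid_index \<gamma> j (z i)
        + (if j = s i then ahead r (s i) else 0)) - ?sg j * grid_coord \<gamma> j (z i)\<bar> \<le> 1" for j
    proof -
      have "of_int (grid_index \<gamma> (s i) (z i)) = grid_coord \<gamma> (s i) (z i)"
        using cr[OF that] by (auto simp: crossing_def grid_index_eq Ints_def)
      moreover have "\<bar>of_int (grid_index \<gamma> j (z i)) - grid_coord \<gamma> j (z i)\<bar> \<le> 1"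
        unfolding grid_index_eq by linarith
      ultimately have "\<bar>of_int (grid_index \<gamma> j (z i)
          + (if j = s i then ahead r (s i) else 0)) - grid_coord \<gamma> j (z i)\<bar> \<le> 1"
        by (auto simp: ahead_def)
      then have "\<bar>?sg j\<bar> * \<bar>of_int (grid_index \<gamma> j (z i)
          + (if j = s i then ahead r (s i) else 0)) - grid_coord \<gamma> j (z i)\<bar> \<le> 1 * 1"
        by (intro mult_mono) (auto simp: sgn_if)
      then show ?thesis by (simp only: right_diff_distrib[symmetric] abs_mult mult_1)
    qed
    then have "(\<Sum>j<5. \<bar>?sg j * of_int (grid_index \<gamma> j (z i)
        + (if j = s i then ahead r (s i) else 0)) - ?sg j * grid_coord \<gamma> j (z i)\<bar>) \<le> of_nat (card
            {..<5::nat}) * 1"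
      by (intro sum_bounded_above) auto
    then show ?thesis unfolding sum_subtractf[symmetric] by (intro order.trans[OF sum_abs]) simp
  qed
  define \<tau> where "\<tau> = ?p (z 40) - ?p (z 0)"
  have "(\<Sum>j<5. ?sg j * grid_coord \<gamma> j (z 40))
      = (\<Sum>j<5. ?sg j * grid_coord \<gamma> j (z 0)) + \<tau> * (\<Sum>j<5. \<bar>cross (zeta ^ r) (zeta ^ j)\<bar>)"
  proof -
    have "grid_coord \<gamma> j (z 40) = grid_coord \<gamma> j (z 0) + \<tau> * cross (zeta ^ r) (zeta ^ j)" for j
      unfolding \<tau>_def using line[of 40] by (intro grid_coord_along_line) simp
    then show ?thesis by (simp add: algebra_simps sum.distrib sum_distrib_left abs_sgn)
  qed
  then have "30 \<le> \<tau> * (\<Sum>j<5. \<bar>cross (zeta ^ r) (zeta ^ j)\<bar>)"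
    using \<Phi>[of 40] \<Phi>_bound[of 0] \<Phi>_bound[of 40] by simp
  moreover have "(\<Sum>j<5. \<bar>cross (zeta ^ r) (zeta ^ j)\<bar>) \<le> of_nat (card {..<5::nat}) * 1"
  proof (rule sum_bounded_above)
    show "\<bar>cross (zeta ^ r) (zeta ^ j)\<bar> \<le> 1" if "j \<in> {..<5}" for j
      using cross_zeta_powers(2)[of r j] r that by (cases "j = r") (auto simp: cross_same)
  qed
  moreover have "0 \<le> (\<Sum>j<5. \<bar>cross (zeta ^ r) (zeta ^ j)\<bar>)" by (intro sum_nonneg) simp
  ultimately have \<tau>: "6 \<le> \<tau>"
  proof -
    let ?k = "\<Sum>j<5. \<bar>cross (zeta ^ r) (zeta ^ j)\<bar>"
    assume k: "30 \<le> \<tau> * ?k" "?k \<le> of_nat (card {..<5::nat}) * 1" "0 \<le> ?k"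
    show ?thesis
    proof (rule ccontr)
      assume "\<not> 6 \<le> \<tau>"
      then have \<tau>: "\<tau> < 6" by simp
      have k5: "?k \<le> 5" using k(2) by simp
      show False
      proof (cases "\<tau> \<le> 0")
        case True
        then have "\<tau> * ?k \<le> 0" using k(3) by (rule mult_nonpos_nonneg)
        then show False using k(1) by linarith
      next
        case False
        then have "\<tau> * ?k \<le> \<tau> * 5" using k5 by (intro mult_left_mono) auto
        then show False using k(1) \<tau> by linarith
      qed
    qed
  qed
  have all: "\<exists>i\<le>n. w = z i"
    if "n \<le> 40" "crossing \<gamma> w r t" "grid_coord \<gamma> r w = grid_coord \<gamma> r (z 0)" "?p (z 0) \<le> ?p w"
        "?p w \<le> ?p (z n)" for n w t
    using that
  proof (induction n)
    case 0
    then have "w = z 0" using eq_if_same_line_and_position[of \<gamma> r "z 0" w] by simp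
    then show ?case by simp
  next
    case (Suc n)
    show ?case
    proof (cases "?p w \<le> ?p (z n)")
      case True
      then have "\<exists>i\<le>n. w = z i" using Suc by simp
      then show ?thesis using le_SucI by blast
    next
      case False
      then have "?p (z (Suc n)) \<le> ?p w" using step(2)[of n w t] Suc.prems line[of n] by simp
      then have "w = z (Suc n)"
        using Suc.prems line[of "Suc n"] eq_if_same_line_and_position[of \<gamma> r "z (Suc n)" w] by simp
      then show ?thesis by blast
    qed
  qed
  show ?thesis
  proof (rule grid_line_segment_sums_not_constant[OF reg r])
    show "grid_coord \<gamma> r (z 0) \<in> \<int>" using cr[of 0] by (simp add: crossing_def)
    show "(\<Sum>j<5. grid_index \<gamma> j (z 0)) \<in> {1, 2}" using sum_grid_index_crossing[OF reg cr[of 0]] by simp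
    fix w t
    assume w: "crossing \<gamma> w r t" "grid_coord \<gamma> r w = grid_coord \<gamma> r (z 0)" "?p (z 0) \<le> ?p w"
        "?p w \<le> ?p (z 0) + 6"
      and "(\<Sum>j<5. grid_index \<gamma> j w) \<noteq> (\<Sum>j<5. grid_index \<gamma> j (z 0))"
    moreover from w \<tau> obtain i where "i \<le> 40" "w = z i" using all[of 40 w t] by (auto simp: \<tau>_def)
    ultimately show ?thesis by blast
  qed
qed

section \<open>The vertex index of a Penrose tiling\<close>

lemma lattice_coefficients_eq:
  assumes "of_int a * zeta ^ i + of_int b * zeta ^ j = of_int c * zeta ^ k"
    and "i < 5" "j < 5" "k < 5" "\<bar>a + b - c\<bar> < 5" "m < 5"
  shows "(if m = i then a else 0) + (if m = j then b else 0) = (if m = k then c else (0::int))"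
proof (rule lattice_point_inj[OF _ _ \<open>m < 5\<close>])
  show "lattice_point (\<lambda>m. (if m = i then a else 0) + (if m = j then b else 0))
    = lattice_point (\<lambda>m. if m = k then c else 0)"
    using assms by (simp add: lattice_point_add lattice_point_unit)
  show "\<bar>(\<Sum>m<5. (if m = i then a else 0)
      + (if m = j then b else 0)) - (\<Sum>m<5. if m = k then c else 0)\<bar> < 5"
    using assms by (simp add: sum.distrib)
qed

lemma cross_zeta_ne_0: "r < 5 \<Longrightarrow> s < 5 \<Longrightarrow> r \<noteq> s \<Longrightarrow> cross (zeta ^ r) (zeta ^ s) \<noteq> 0"
  using cross_zeta_powers(1)[of r s] by auto

lemma extreme_points_zeta_tile:
  assumes "r < 5" "s < 5" "r \<noteq> s" "x extreme_point_of zeta_tile p r s"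
  obtains a b :: int where "a \<in> {0, 1}" "b \<in> {0, 1}" "x = p + of_int a * zeta ^ r + of_int b * zeta ^ s"
proof -
  have "x \<in> {p, p + zeta ^ r, p + zeta ^ s, p + zeta ^ r + zeta ^ s}"
    using assms(4) extreme_points_parallelogram[OF cross_zeta_ne_0[OF assms(1-3)]] by blast
  then show thesis
    using that[of 0 0] that[of 1 0] that[of 0 1] that[of 1 1] by auto
qed

text \<open>
  Each first corner is reached from the other one by nonnegative multiples of two side vectors.
  The coefficients of both displacements add up to 0, up to a multiple of \<open>(1, \<dots>, 1)\<close>; there are
  at most four terms, so that multiple is 0 and all of them vanish.
\<close>

lemma zeta_tile_eq:
  assumes rs: "r < 5" "s < 5" "r \<noteq> s" and rs': "r' < 5" "s' < 5" "r' \<noteq> s'"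
    and eq: "zeta_tile p r s = zeta_tile p' r' s'"
  shows "p = p'" "{r, s} = {r', s'}"
proof -
  note ext = extreme_points_parallelogram[OF cross_zeta_ne_0[OF rs]]
  note ext' = extreme_points_parallelogram[OF cross_zeta_ne_0[OF rs']]
  have "p' extreme_point_of zeta_tile p r s" unfolding eq ext' by blast
  from extreme_points_zeta_tile[OF rs this] obtain a b :: int
    where ab: "a \<in> {0, 1}" "b \<in> {0, 1}" "p' = p + of_int a * zeta ^ r + of_int b * zeta ^ s" .
  have "p extreme_point_of zeta_tile p' r' s'" unfolding eq[symmetric] ext by blast
  from extreme_points_zeta_tile[OF rs' this] obtain c d :: int
    where cd: "c \<in> {0, 1}" "d \<in> {0, 1}" "p = p' + of_int c * zeta ^ r' + of_int d * zeta ^ s'" .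
  let ?n = "\<lambda>j. (if j = r then a else 0) + (if j = s then b else 0)"
  let ?n' = "\<lambda>j. (if j = r' then c else 0) + (if j = s' then d else 0)"
  have n: "lattice_point ?n = of_int a * zeta ^ r + of_int b * zeta ^ s"
    "lattice_point ?n' = of_int c * zeta ^ r' + of_int d * zeta ^ s'"
    using rs rs' by (simp_all add: lattice_point_add lattice_point_unit)
  have "lattice_point (\<lambda>j. ?n j + ?n' j) = lattice_point ?n + lattice_point ?n'"
      by (rule lattice_point_add)
  also have "\<dots> = lattice_point (\<lambda>j. 0)" unfolding n using ab(3) cd(3)
      by (simp add: lattice_point_def add_ac)
  finally have zero: "lattice_point (\<lambda>j. ?n j + ?n' j) = lattice_point (\<lambda>j. 0)" .
  have "?n j + ?n' j = 0" if "j < 5" for j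
  proof (rule lattice_point_inj[OF zero _ that])
    show "\<bar>(\<Sum>j<5. ?n j + ?n' j) - (\<Sum>j<5::nat. 0)\<bar> < 5"
      using rs rs' ab cd by (auto simp: sum.distrib)
  qed
  from this[of r] this[of s] have "a = 0" "b = 0"
    using rs ab(1,2) cd(1,2) by (auto split: if_splits)
  then show p: "p = p'" using ab by simp
  have mem: "k = r \<or> k = s" if "k = r' \<or> k = s'" for k
  proof (rule ccontr)
    assume k: "\<not> ?thesis"
    have k5: "k < 5" using that rs' by auto
    have "p' + zeta ^ k extreme_point_of zeta_tile p r s"
      unfolding eq ext' using that by blast
    from extreme_points_zeta_tile[OF rs this] obtain a b :: int
      where ab: "a \<in> {0, 1}" "b \<in> {0, 1}"
          "p' + zeta ^ k = p + of_int a * zeta ^ r + of_int b * zeta ^ s" .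
    have "of_int a * zeta ^ r + of_int b * zeta ^ s = of_int 1 * zeta ^ k" using ab(3) p by simp
    from lattice_coefficients_eq[OF this rs(1,2) k5 _ k5] ab(1,2) k show False by auto
  qed
  from mem[of r'] mem[of s'] rs' show "{r, s} = {r', s'}" by auto
qed

text \<open>
  Comparing coefficients, a difference of two corners of a tile is a power of \<open>zeta\<close> only if it
  is a side.
\<close>

lemma zeta_tile_with_edge:
  assumes rs': "r' < 5" "s' < 5" "r' \<noteq> s'" and r: "r < 5"
    and ext: "x extreme_point_of zeta_tile q r' s'"
      "x + zeta ^ r extreme_point_of zeta_tile q r' s'"
  obtains s and e :: int where "s < 5" "s \<noteq> r" "e \<in> {0, 1}" "x = q + of_int e * zeta ^ s"
    "zeta_tile q r' s' = zeta_tile q r s"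
proof -
  obtain a b :: int where ab: "a \<in> {0, 1}" "b \<in> {0, 1}"
      "x = q + of_int a * zeta ^ r' + of_int b * zeta ^ s'"
    using extreme_points_zeta_tile[OF rs' ext(1)] .
  obtain c d :: int where cd: "c \<in> {0, 1}" "d \<in> {0, 1}"
      "x + zeta ^ r = q + of_int c * zeta ^ r' + of_int d * zeta ^ s'"
    using extreme_points_zeta_tile[OF rs' ext(2)] .
  have "of_int (c - a) * zeta ^ r' + of_int (d - b) * zeta ^ s' = of_int 1 * zeta ^ r"
    using ab(3) cd(3) by (simp add: algebra_simps)
  then have coeff: "(if m = r' then c - a else 0) + (if m = s' then d - b else 0)
      = (if m = r then 1 else (0::int))"
    if "m < 5" for m
    by (rule lattice_coefficients_eq) (use rs' r ab(1,2) cd(1,2) that in auto)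
  consider "r = r'" | "r = s'" using coeff[OF r] by (auto split: if_splits)
  then show thesis
  proof cases
    case 1
    then have "a = 0" using coeff[OF r] rs' ab cd by auto
    then show thesis using that[of s' b] 1 rs' ab by simp
  next
    case 2
    then have "b = 0" using coeff[OF r] rs' ab cd by auto
    then show thesis using that[of r' a] 2 rs' ab parallelogram_symmetries(1) by simp
  qed
qed

lemma penrose_patch:
  assumes "unit_penrose_tiling \<U>" "finite P" "P \<subseteq> \<U>"
  shows "\<exists>\<gamma> t. regular_pentagrid \<gamma> \<and> (\<forall>T\<in>P. \<exists>z r s. crossing \<gamma> z r s \<and>
      T = zeta_tile (grid_corner \<gamma> z - t) r s)"
proof -
  obtain \<gamma> t where reg: "regular_pentagrid \<gamma>" and P: "\<forall>T\<in>P. (\<lambda>z. t + z) ` T \<in> pentagrid_tiling \<gamma>"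
    using assms by (auto simp: unit_penrose_tiling_def)
  have "\<exists>z r s. crossing \<gamma> z r s \<and>
      T = zeta_tile (grid_corner \<gamma> z - t) r s" if "T \<in> P" for T
  proof -
    from that
    obtain z r s where cr: "crossing \<gamma> z r s"
      and T: "(\<lambda>z. t + z) ` T = zeta_tile (grid_corner \<gamma> z) r s"
      using P pentagrid_tiling_iff by metis
    have "T = (\<lambda>z. - t + z) ` (\<lambda>z. t + z) ` T" by (simp add: image_image)
    also have "\<dots> = zeta_tile (grid_corner \<gamma> z - t) r s"
      unfolding T translate_parallelogram by simp
    finally show ?thesis using cr by blast
  qed
  with reg show ?thesis by blast
qed

lemma penrose_tile:
  assumes "unit_penrose_tiling \<U>" "T \<in> \<U>"
  obtains q r s where "r < 5" "s < 5" "r \<noteq> s" "T = zeta_tile q r s"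
proof -
  from penrose_patch[OF assms(1), of "{T}"] assms(2)
  obtain \<gamma> t z r s where "crossing \<gamma> z r s"
    "T = zeta_tile (grid_corner \<gamma> z - t) r s" by auto
  then show thesis using that unfolding crossing_def by blast
qed

lemma penrose_next_tile_in_strip:
  assumes \<U>: "unit_penrose_tiling \<U>" and T: "zeta_tile q r s \<in> \<U>"
    and rs: "r < 5" "s < 5" "s \<noteq> r"
  obtains q' s' and e :: int where "zeta_tile q' r s' \<in> \<U>" "s' < 5" "s' \<noteq> r" "e \<in> {0, 1}"
    "zeta_tile q' r s' \<noteq> zeta_tile q r s"
    "q' + of_int e * zeta ^ s' = q + of_int (ahead r s) * zeta ^ s"
proof -
  define p where "p = q + of_int (ahead r s) * zeta ^ s"
  \<comment> \<open>Presenting the tile from the corner \<open>p\<close> turns the side ahead into the first side.\<close>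
  define v where "v = (if ahead r s = 0 then zeta ^ s else - (zeta ^ s))"
  have T': "zeta_tile q r s = parallelogram p (zeta ^ r) v"
    unfolding p_def v_def using parallelogram_symmetries(2)[of q "zeta ^ r" "zeta ^ s"]
        by (simp add: ahead_def)
  have cross: "cross (zeta ^ r) v \<noteq> 0"
    unfolding v_def using cross_zeta_ne_0[OF rs(1,2)] rs(3) by (auto simp: cross_linear)
  obtain S where S: "S \<in> \<U>" "S \<noteq> parallelogram p (zeta ^ r) v" "p extreme_point_of S"
      "p + zeta ^ r extreme_point_of S"
  proof (rule neighbour_across_edge[of \<U> p "zeta ^ r" v])
    show "plane_tiling \<U>" "edge_to_edge \<U>" using \<U> by (simp_all add: unit_penrose_tiling_def)
    show "\<exists>p u v::complex. norm u = 1 \<and> norm v = 1 \<and> 1 / 2 \<le> \<bar>cross u v\<bar> \<and> T = parallelogram p u v"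
        if "T \<in> \<U>" for T
      using penrose_tile[OF \<U> that] cross_zeta_powers(1) norm_zeta_power by metis
    show "parallelogram p (zeta ^ r) v \<in> \<U>" using T T' by simp
    show "cross (zeta ^ r) v \<noteq> 0" by (rule cross)
  qed
  obtain q' r' s' where S': "r' < 5" "s' < 5" "r' \<noteq> s'" "S = zeta_tile q' r' s'"
    using penrose_tile[OF \<U> S(1)] .
  obtain s'' and e :: int where s'': "s'' < 5" "s'' \<noteq> r" "e \<in> {0, 1}" "p = q' + of_int e * zeta ^ s''"
    "zeta_tile q' r' s' = zeta_tile q' r s''"
    using zeta_tile_with_edge[OF S'(1-3) rs(1) S(3,4)[unfolded S'(4)]] .
  show thesis
  proof (rule that[OF _ s''(1-3)])
    show "zeta_tile q' r s'' \<in> \<U>"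
      using S(1) unfolding S'(4) s''(5) .
    show "zeta_tile q' r s'' \<noteq> zeta_tile q r s"
      using S(2) unfolding S'(4) s''(5) T' .
    show "q' + of_int e * zeta ^ s'' = q + of_int (ahead r s) * zeta ^ s"
      using s''(4) unfolding p_def by (rule sym)
  qed
qed

lemma penrose_strip:
  assumes \<U>: "unit_penrose_tiling \<U>" and T: "zeta_tile q0 r s0 \<in> \<U>"
    and rs: "r < 5" "s0 < 5" "s0 \<noteq> r"
  shows "\<exists>q s. q 0 = q0 \<and> (\<forall>i::nat.
    s i < 5 \<and> s i \<noteq> r \<and> zeta_tile (q i) r (s i) \<in> \<U> \<and>
    zeta_tile (q (Suc i)) r (s (Suc i)) \<noteq> zeta_tile (q i) r (s i) \<and>
    (\<exists>e\<in>{0, 1}. q (Suc i) + of_int e * zeta ^ s (Suc i) = q i + of_int (ahead r (s i)) * zeta ^ s i))"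
proof -
  let ?P = "\<lambda>(n::nat) x. snd x < 5 \<and> snd x \<noteq> r \<and> zeta_tile (fst x) r (snd x) \<in> \<U> \<and> (n = 0 \<longrightarrow> fst x = q0)"
  let ?Q = "\<lambda>(n::nat) x y. zeta_tile (fst y) r (snd y) \<noteq> zeta_tile (fst x) r (snd x) \<and>
    (\<exists>e\<in>{0, 1}. fst y + of_int e * zeta ^ snd y = fst x + of_int (ahead r (snd x)) * zeta ^ snd x)"
  have "\<exists>f. \<forall>n. ?P n (f n) \<and> ?Q n (f n) (f (Suc n))"
  proof (rule dependent_nat_choice)
    show "\<exists>x. ?P 0 x" by (rule exI[of _ "(q0, s0)"]) (simp add: T rs)
    fix x n assume x: "?P n x"
    then show "\<exists>y. ?P (Suc n) y \<and> ?Q n x y"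
    proof (elim conjE)
      assume x: "snd x < 5" "snd x \<noteq> r" "zeta_tile (fst x) r (snd x) \<in> \<U>"
      obtain q' s' and e :: int where "zeta_tile q' r s' \<in> \<U>" "s' < 5" "s' \<noteq> r" "e \<in> {0, 1}"
        "zeta_tile q' r s' \<noteq> zeta_tile (fst x) r (snd x)"
        "q' + of_int e * zeta ^ s' = fst x + of_int (ahead r (snd x)) * zeta ^ snd x"
        using penrose_next_tile_in_strip[OF \<U> x(3) rs(1) x(1,2)] .
      then show ?thesis by (intro exI[of _ "(q', s')"]) auto
    qed
  qed
  then obtain f where f: "\<forall>n. ?P n (f n) \<and> ?Q n (f n) (f (Suc n))" ..
  show ?thesis
  proof (intro exI[of _ "\<lambda>i. fst (f i)"] exI[of _ "\<lambda>i. snd (f i)"] conjI[OF _ allI])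
    show "fst (f 0) = q0" using spec[OF f, of 0] by blast
    fix i
    show "snd (f i) < 5 \<and> snd (f i) \<noteq> r \<and> zeta_tile (fst (f i)) r (snd (f i)) \<in> \<U> \<and>
      zeta_tile (fst (f (Suc i))) r (snd (f (Suc i))) \<noteq> zeta_tile (fst (f i)) r (snd (f i)) \<and>
      (\<exists>e\<in>{0, 1}. fst (f (Suc i)) + of_int e * zeta ^ snd (f (Suc i)) = fst (f i) + of_int (ahead r (snd
          (f i))) * zeta ^ snd (f i))"
      using spec[OF f, of i] by (elim conjE, intro conjI)
  qed
qed

text \<open>
  A strip of 41 tiles is a finite patch, so it occurs in a pentagrid tiling; there consecutive
  tiles belong to intersection points that \<open>strip_walk_sums_not_constant\<close> applies to.
\<close>

lemma penrose_strip_changes_level: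
  assumes \<U>: "unit_penrose_tiling \<U>" and T: "zeta_tile q0 r s0 \<in> \<U>"
    and rs: "r < 5" "s0 < 5" "s0 \<noteq> r"
  obtains q s n where "s < 5" "s \<noteq> r" "zeta_tile q r s \<in> \<U>"
    "q = q0 + lattice_point n" "(\<Sum>j<5. n j) \<in> {-1, 1}"
proof -
  from penrose_strip[OF assms] obtain q s where q0: "q 0 = q0"
    and strip: "\<forall>i::nat. s i < 5 \<and> s i \<noteq> r \<and> zeta_tile (q i) r (s i) \<in> \<U> \<and>
      zeta_tile (q (Suc i)) r (s (Suc i)) \<noteq> zeta_tile (q i) r (s i) \<and>
      (\<exists>e\<in>{0, 1}. q (Suc i) + of_int e * zeta ^ s (Suc i) = q i + of_int (ahead r (s i)) * zeta ^ s i)"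
    by (elim exE conjE)
  have s_lt: "s i < 5" "s i \<noteq> r" and in_tiling: "zeta_tile (q i) r (s i) \<in> \<U>"
    and new: "zeta_tile (q (Suc i)) r (s (Suc i)) \<noteq> zeta_tile (q i) r (s i)"
    and edge: "\<exists>e\<in>{0, 1}. q (Suc i) + of_int e * zeta ^ s (Suc i)
        = q i + of_int (ahead r (s i)) * zeta ^ s i" for i
    using spec[OF strip, of i] by blast+
  let ?T = "\<lambda>i. zeta_tile (q i) r (s i)"
  have "?T ` {..40} \<subseteq> \<U>" using in_tiling by blast
  then obtain \<gamma> t where reg: "regular_pentagrid \<gamma>"
    and patch: "\<forall>T\<in>?T ` {..40}. \<exists>z r s. crossing \<gamma> z r s \<and>
      T = zeta_tile (grid_corner \<gamma> z - t) r s"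
    using penrose_patch[OF \<U>, of "?T ` {..40}"] by blast
  have "\<exists>z. crossing \<gamma> z r (s i) \<and> q i = grid_corner \<gamma> z - t" if "i \<le> 40" for i
  proof -
    obtain z r' s' where cr: "crossing \<gamma> z r' s'"
      and eq: "?T i = zeta_tile (grid_corner \<gamma> z - t) r' s'"
      using patch \<open>i \<le> 40\<close> by blast
    have 5: "r' < 5" "s' < 5" "r' \<noteq> s'" "s i < 5" "r \<noteq> s i" using cr s_lt[of i]
        by (auto simp: crossing_def)
    from zeta_tile_eq[OF rs(1) 5(4,5,1,2,3) eq]
    have "q i = grid_corner \<gamma> z - t" "r = r' \<and> s i = s' \<or> r = s' \<and> s i = r'"
      by (auto simp: doubleton_eq_iff)
    then show ?thesis using cr crossing_sym by blast
  qed
  then have "\<forall>i\<in>{..40}. \<exists>z. crossing \<gamma> z r (s i) \<and> q i = grid_corner \<gamma> z - t" by simp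
  from bchoice[OF this] obtain z
      where "\<forall>i\<in>{..40}. crossing \<gamma> (z i) r (s i) \<and> q i = grid_corner \<gamma> (z i) - t" ..
  then have z: "crossing \<gamma> (z i) r (s i)" "q i = grid_corner \<gamma> (z i) - t" if "i \<le> 40" for i
    using that by simp_all
  have "\<exists>i\<le>40. (\<Sum>j<5. grid_index \<gamma> j (z i)) \<noteq> (\<Sum>j<5. grid_index \<gamma> j (z 0))"
  proof (rule strip_walk_sums_not_constant[OF reg z(1)])
    fix i :: nat assume i: "i < 40"
    show "z (Suc i) \<noteq> z i"
    proof
      assume eq: "z (Suc i) = z i"
      have "crossing \<gamma> (z i) r (s (Suc i))" using z(1)[of "Suc i"] i eq by simp
      then have "s (Suc i) = s i"
        using crossing_not_Ints[OF reg z(1)[of i], of "s (Suc i)"] i s_lt[of "Suc i"]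
            by (auto simp: crossing_def)
      moreover have "q (Suc i) = q i" using z(2)[of i] z(2)[of "Suc i"] i eq by simp
      ultimately show False using new[of i] by simp
    qed
    show "\<exists>e\<in>{0, 1}. grid_corner \<gamma> (z (Suc i)) + of_int e * zeta ^ s (Suc i)
      = grid_corner \<gamma> (z i) + of_int (ahead r (s i)) * zeta ^ s i"
      using edge[of i] z(2)[of i] z(2)[of "Suc i"] i by (simp add: diff_add_eq)
  qed
  then obtain i where i: "i \<le> 40" "(\<Sum>j<5. grid_index \<gamma> j (z i)) \<noteq> (\<Sum>j<5. grid_index \<gamma> j (z 0))" by blast
  let ?n = "\<lambda>j. grid_index \<gamma> j (z i) - grid_index \<gamma> j (z 0)"
  have "q i = q0 + lattice_point ?n" using z(2)[OF i(1)] z(2)[of 0] q0 by (simp add: lattice_point_diff)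
  moreover have "(\<Sum>j<5. ?n j) \<in> {-1, 1}"
    using i(2) sum_grid_index_crossing[OF reg z(1)[OF i(1)]] sum_grid_index_crossing[OF reg z(1)[of 0]]
    by (auto simp: sum_subtractf)
  ultimately show thesis using that[OF s_lt[of i] in_tiling[of i]] by blast
qed

text \<open>
  The constant \<open>c\<close> is the index of the base vertex \<open>p0\<close>. If 1 and 2 each failed for some tile,
  these two tiles and the base tile would lie in one pentagrid tiling, which assigns \<open>p0\<close> one of
  these indices.
\<close>

lemma penrose_levels:
  assumes \<U>: "unit_penrose_tiling \<U>"
  obtains p0 and c :: int where "\<And>T. T \<in> \<U> \<Longrightarrow> \<exists>q r s n. r < 5 \<and> s < 5 \<and> r \<noteq> s \<and>
    T = zeta_tile q r s \<and> q = p0 + lattice_point n \<and> c + (\<Sum>j<5. n j) \<in> {1, 2}"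
proof -
  have "\<U> \<noteq> {}" using \<U> by (auto simp: unit_penrose_tiling_def plane_tiling_def)
  then obtain T0 where T0: "T0 \<in> \<U>" by blast
  obtain p0 r0 s0 where p0: "r0 < 5" "s0 < 5" "r0 \<noteq> s0" "T0 = zeta_tile p0 r0 s0"
    using penrose_tile[OF \<U> T0] .
  define good where "good c T \<longleftrightarrow> (\<exists>q r s n. r < 5 \<and> s < 5 \<and> r \<noteq> s \<and>
    T = zeta_tile q r s \<and> q = p0 + lattice_point n \<and> c + (\<Sum>j<5. n j) \<in> {1, 2::int})"
    for c T
  have "\<exists>c\<in>{1, 2}. \<forall>T\<in>\<U>. good c T"
  proof (rule ccontr)
    assume "\<not> ?thesis"
    then obtain T1 T2 where T12: "T1 \<in> \<U>" "\<not> good 1 T1" "T2 \<in> \<U>" "\<not> good 2 T2" by blast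
    obtain \<gamma> t where reg: "regular_pentagrid \<gamma>"
      and patch: "\<forall>T\<in>{T0, T1, T2}. \<exists>z r s. crossing \<gamma> z r s \<and>
        T = zeta_tile (grid_corner \<gamma> z - t) r s"
      using penrose_patch[OF \<U>, of "{T0, T1, T2}"] T0 T12 by blast
    obtain z0 r s where z0: "crossing \<gamma> z0 r s"
      "T0 = zeta_tile (grid_corner \<gamma> z0 - t) r s"
      using patch by blast
    have p0_eq: "p0 = grid_corner \<gamma> z0 - t"
    proof (rule zeta_tile_eq(1)[OF p0(1-3)])
      show "r < 5" "s < 5" "r \<noteq> s" using z0 by (auto simp: crossing_def)
    qed (use p0 z0 in simp)
    let ?c = "\<Sum>j<5. grid_index \<gamma> j z0"
    have good_c: "good ?c T" if T: "T \<in> {T0, T1, T2}" for T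
    proof -
      obtain z r s where z: "crossing \<gamma> z r s"
        "T = zeta_tile (grid_corner \<gamma> z - t) r s"
        using patch T by blast
      have "grid_corner \<gamma> z - t = p0 + lattice_point (\<lambda>j. grid_index \<gamma> j z - grid_index \<gamma> j z0)"
        by (simp add: p0_eq lattice_point_diff)
      moreover have "?c + (\<Sum>j<5. grid_index \<gamma> j z - grid_index \<gamma> j z0) \<in> {1, 2}"
        using sum_grid_index_crossing[OF reg z(1)] by (simp add: sum_subtractf)
      moreover have "r < 5" "s < 5" "r \<noteq> s" using z by (auto simp: crossing_def)
      ultimately show ?thesis unfolding good_def using z(2) by (intro exI conjI)
    qed
    have "?c = 1 \<or> ?c = 2" using sum_grid_index_crossing[OF reg z0(1)] by simp
    then show False using good_c[of T1] good_c[of T2] T12 by auto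
  qed
  then obtain c where "\<forall>T\<in>\<U>. good c T" by blast
  then show thesis using that[of p0 c] unfolding good_def by simp
qed

text \<open>
  Any representation of \<open>w\<close> relative to \<open>p0\<close> gives the same value. Points without such a
  representation are not vertices of the tiling in question, and their value is arbitrary.
\<close>

definition vertex_index :: "complex \<Rightarrow> int \<Rightarrow> complex \<Rightarrow> int" where
  "vertex_index p0 c w = (c + (\<Sum>j<5. (SOME n. w = p0 + lattice_point n) j)) mod 5"

lemma vertex_index_lattice_point:
  "vertex_index p0 c (p0 + lattice_point n) = (c + (\<Sum>j<5. n j)) mod 5"
proof -
  define m where "m = (SOME m. p0 + lattice_point n = p0 + lattice_point m)"
  have "p0 + lattice_point n = p0 + lattice_point m"
    unfolding m_def by (rule someI[of _ n]) simp
  then have "(\<Sum>j<5. m j) mod 5 = (\<Sum>j<5. n j) mod 5" by (intro lattice_point_eq_sum) simp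
  then have "(c + (\<Sum>j<5. m j)) mod 5 = (c + (\<Sum>j<5. n j)) mod 5" by (rule mod_add_cong[OF refl])
  then show ?thesis by (simp only: vertex_index_def m_def)
qed

text \<open>
  Reduction modulo 5 loses nothing as the indices are 1, 2, 3 and 4. A tile that starts at index
  1 and one that starts at index 2 have all of these values at their corners.
\<close>

lemma penrose_vertex_index:
  assumes \<U>: "unit_penrose_tiling \<U>"
  shows "\<exists>\<iota> :: complex \<Rightarrow> int.
    (\<forall>T\<in>\<U>. \<exists>q r s. r < 5 \<and> s < 5 \<and> r \<noteq> s \<and> T = zeta_tile q r s \<and>
      \<iota> q \<in> {1, 2} \<and> \<iota> (q + zeta ^ r) = \<iota> q + 1 \<and> \<iota> (q + zeta ^ s) = \<iota> q + 1 \<and>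
      \<iota> (q + zeta ^ r + zeta ^ s) = \<iota> q + 2) \<and>
    \<iota> ` tiling_vertices \<U> = {1, 2, 3, 4}"
proof -
  obtain p0 c where levels: "\<And>T. T \<in> \<U> \<Longrightarrow> \<exists>q r s n. r < 5 \<and> s < 5 \<and> r \<noteq> s \<and>
    T = zeta_tile q r s \<and> q = p0 + lattice_point n \<and> c + (\<Sum>j<5. n j) \<in> {1, 2}"
    using penrose_levels[OF \<U>] by blast
  define \<iota> where "\<iota> = vertex_index p0 c"
  have \<iota>: "\<iota> (p0 + lattice_point n) = (c + (\<Sum>j<5. n j)) mod 5" for n
    unfolding \<iota>_def by (rule vertex_index_lattice_point)
  have tile: "\<exists>q r s. r < 5 \<and> s < 5 \<and> r \<noteq> s \<and> T = zeta_tile q r s \<and>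
      \<iota> q \<in> {1, 2} \<and> \<iota> (q + zeta ^ r) = \<iota> q + 1 \<and> \<iota> (q + zeta ^ s) = \<iota> q + 1 \<and>
      \<iota> (q + zeta ^ r + zeta ^ s) = \<iota> q + 2 \<and> (\<exists>n. q = p0 + lattice_point n)" if TU: "T \<in> \<U>" for T
  proof -
    obtain q r s n where rs: "r < 5" "s < 5" "r \<noteq> s" and T: "T = zeta_tile q r s"
      and q: "q = p0 + lattice_point n" and c: "c + (\<Sum>j<5. n j) \<in> {1, 2}"
      using levels[OF TU] by blast
    let ?e = "\<lambda>r j. if j = r then 1 else (0::int)"
    have unit: "lattice_point (?e r) = zeta ^ r" "lattice_point (?e s) = zeta ^ s"
      using rs by (simp_all add: lattice_point_unit)
    have "q + zeta ^ r = p0 + lattice_point (\<lambda>j. n j + ?e r j)"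
      "q + zeta ^ s = p0 + lattice_point (\<lambda>j. n j + ?e s j)"
      "q + zeta ^ r + zeta ^ s = p0 + lattice_point (\<lambda>j. n j + ?e r j + ?e s j)"
      unfolding lattice_point_add unit q by (simp_all only: add.assoc)
    then have "\<iota> q = (c + (\<Sum>j<5. n j)) mod 5" "\<iota> (q + zeta ^ r) = (c + (\<Sum>j<5. n j) + 1) mod 5"
      "\<iota> (q + zeta ^ s) = (c + (\<Sum>j<5. n j) + 1) mod 5"
          "\<iota> (q + zeta ^ r + zeta ^ s) = (c + (\<Sum>j<5. n j) + 2) mod 5"
      using rs by (simp_all only: \<iota> q) (simp_all add: sum.distrib add.assoc)
    then show ?thesis using rs T q c by (intro exI[of _ q] exI[of _ r] exI[of _ s]) auto
  qed
  have "\<U> \<noteq> {}" using \<U> by (auto simp: unit_penrose_tiling_def plane_tiling_def)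
  then obtain T0 where T0: "T0 \<in> \<U>" by blast
  from tile[OF T0] obtain q0 r s0 n0 where q0: "r < 5" "s0 < 5" "r \<noteq> s0" "T0 = zeta_tile q0 r s0"
    "\<iota> q0 \<in> {1, 2}" "q0 = p0 + lattice_point n0" "\<iota> (q0 + zeta ^ r) = \<iota> q0 + 1"
    "\<iota> (q0 + zeta ^ s0) = \<iota> q0 + 1" "\<iota> (q0 + zeta ^ r + zeta ^ s0) = \<iota> q0 + 2" by blast
  have "zeta_tile q0 r s0 \<in> \<U>" "s0 \<noteq> r" using T0 q0(3,4) by auto
  from penrose_strip_changes_level[OF \<U> this(1) q0(1,2) this(2)]
  obtain q s n where q: "s < 5" "s \<noteq> r" "zeta_tile q r s \<in> \<U>"
    "q = q0 + lattice_point n" "(\<Sum>j<5. n j) \<in> {-1, 1}" .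
  from tile[OF q(3)] obtain q' r' s' where q': "r' < 5" "s' < 5" "r' \<noteq> s'"
    "zeta_tile q r s = zeta_tile q' r' s'" "\<iota> q' \<in> {1, 2}"
    "\<iota> (q' + zeta ^ r') = \<iota> q' + 1" "\<iota> (q' + zeta ^ s') = \<iota> q' + 1"
        "\<iota> (q' + zeta ^ r' + zeta ^ s') = \<iota> q' + 2" by blast
  have q_eq: "q' = q" using zeta_tile_eq(1)[OF q0(1) q(1) q(2)[symmetric] q'(1-4)] by simp
  then have "\<iota> q \<in> {1, 2}" using q'(5) by simp
  have "\<iota> q \<noteq> \<iota> q0"
  proof -
    have "q = p0 + lattice_point (\<lambda>j. n0 j + n j)" using q(4) q0(6)
        by (simp add: lattice_point_add add.assoc)
    then have "\<iota> q = (c + (\<Sum>j<5. n0 j) + (\<Sum>j<5. n j)) mod 5" by (simp only: \<iota> sum.distrib add.assoc)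
    moreover have "\<iota> q0 = (c + (\<Sum>j<5. n0 j)) mod 5" by (simp only: \<iota> q0(6))
    ultimately show ?thesis using q(5) by auto presburger+
  qed
  have vertices: "{\<iota> q, \<iota> q + 1, \<iota> q + 2} = \<iota> ` {x. x extreme_point_of zeta_tile q r s}"
    if "r < 5" "s < 5" "r \<noteq> s" "\<iota> (q + zeta ^ r) = \<iota> q + 1" "\<iota> (q + zeta ^ s) = \<iota> q + 1"
      "\<iota> (q + zeta ^ r + zeta ^ s) = \<iota> q + 2" for q r s
    unfolding extreme_points_parallelogram[OF cross_zeta_ne_0[OF that(1-3)]] Collect_mem_eq image_insert
        image_empty
      using that(4-6) by simp
  have tile_image: "\<exists>i\<in>{1, 2}. \<iota> ` {x. x extreme_point_of T} = {i, i + 1, i + 2}" if TU: "T \<in> \<U>" for T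
  proof -
    from tile[OF TU] obtain q r s where qrs: "r < 5" "s < 5" "r \<noteq> s" "T = zeta_tile q r s"
      "\<iota> q \<in> {1, 2}" "\<iota> (q + zeta ^ r) = \<iota> q + 1" "\<iota> (q + zeta ^ s) = \<iota> q + 1"
      "\<iota> (q + zeta ^ r + zeta ^ s) = \<iota> q + 2" by blast
    from vertices[OF qrs(1-3,6-8)] show ?thesis using qrs(4,5) by blast
  qed
  have image: "\<iota> ` tiling_vertices \<U> = (\<Union>T\<in>\<U>. \<iota> ` {x. x extreme_point_of T})"
    by (auto simp: tiling_vertices_def)
  have "\<iota> ` tiling_vertices \<U> = {1, 2, 3, 4}"
  proof (intro equalityI subsetI)
    fix i assume "i \<in> \<iota> ` tiling_vertices \<U>"
    then obtain T where "T \<in> \<U>" "i \<in> \<iota> ` {x. x extreme_point_of T}" unfolding image by blast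
    then show "i \<in> {1, 2, 3, 4}" using tile_image[of T] by auto
  next
    fix i :: int assume "i \<in> {1, 2, 3, 4}"
    then have "i \<in> {\<iota> q0, \<iota> q0 + 1, \<iota> q0 + 2} \<union> {\<iota> q, \<iota> q + 1, \<iota> q + 2}"
      using q0(5) \<open>\<iota> q \<in> {1, 2}\<close> \<open>\<iota> q \<noteq> \<iota> q0\<close> by auto
    moreover have "{\<iota> q0, \<iota> q0 + 1, \<iota> q0 + 2} \<subseteq> \<iota> ` tiling_vertices \<U>"
      unfolding image vertices[OF q0(1-3,7-9)] using T0 q0(4) by blast
    moreover have "{\<iota> q, \<iota> q + 1, \<iota> q + 2} \<subseteq> \<iota> ` tiling_vertices \<U>"
      using q(3) unfolding image vertices[OF q'(1-3,6-8), unfolded q_eq] q'(4)[unfolded q_eq] by blast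
    ultimately show "i \<in> \<iota> ` tiling_vertices \<U>" by blast
  qed
  moreover have "\<forall>T\<in>\<U>. \<exists>q r s. r < 5 \<and> s < 5 \<and> r \<noteq> s \<and> T = zeta_tile q r s \<and>
      \<iota> q \<in> {1, 2} \<and> \<iota> (q + zeta ^ r) = \<iota> q + 1 \<and> \<iota> (q + zeta ^ s) = \<iota> q + 1 \<and>
      \<iota> (q + zeta ^ r + zeta ^ s) = \<iota> q + 2"
    using tile by blast
  ultimately show ?thesis by blast
qed

section \<open>The diamond rule\<close>

lemma inner_zeta_powers:
  assumes "i < 5" "j < 5" "i \<noteq> j"
  shows "inner (zeta ^ i) (zeta ^ j) \<in> {cos (2 * pi / 5), - cos (2 * pi / 5) - 1 / 2}"
proof -
  define c s where cs_def: "c = cos (2 * pi / 5)" "s = sin (2 * pi / 5)"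
  have cc: "c * c = 1 / 4 - c / 2" using cos72_equation by (simp add: power2_eq_square cs_def)
  have "s * s = 1 - c * c" using sin_squared_eq[of "2 * pi / 5"] by (simp add: cs_def power2_eq_square)
  then have ss: "s * s = 3 / 4 + c / 2" using cc by simp
  have cc': "c * (c * x) = x / 4 - c * x / 2" for x
    unfolding mult.assoc[symmetric] cc by (simp add: algebra_simps)
  have ss': "s * (s * x) = 3 * x / 4 + c * x / 2" for x
    unfolding mult.assoc[symmetric] ss by (simp add: algebra_simps)
  have "inner (zeta ^ i) (zeta ^ j) \<in> {c, - c - 1 / 2}"
    using assms
    by (elim less5_cases) (simp_all only: zeta_powers inner_complex_def cs_def[symmetric], simp_all add:
        algebra_simps cc ss cc' ss' add_divide_distrib diff_divide_distrib)
  then show ?thesis by (simp add: cs_def)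
qed

lemma rhombus_sides_inner:
  assumes "rhombus_sides s \<theta> u v"
  shows "0 < s" "norm u = s" "norm v = s" "inner u v = s\<^sup>2 * cos \<theta>"
proof -
  show s: "0 < s" "norm u = s" "norm v = s" using assms by (auto simp: rhombus_sides_def)
  have "\<bar>inner u v\<bar> \<le> norm u * norm v" by (rule Cauchy_Schwarz_ineq2)
  then have "\<bar>inner u v / (norm u * norm v)\<bar> \<le> 1" using s by (simp add: abs_divide)
  moreover have "arccos (inner u v / (norm u * norm v)) = \<theta>"
    using assms unfolding rhombus_sides_def vec_angle_def by blast
  ultimately have "cos \<theta> = inner u v / (norm u * norm v)" using cos_arccos_abs by blast
  then show "inner u v = s\<^sup>2 * cos \<theta>" using s by (simp add: power2_eq_square)
qed

lemma cross_squared: "(cross u v)\<^sup>2 = (norm u)\<^sup>2 * (norm v)\<^sup>2 - (inner u v)\<^sup>2"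
  unfolding cmod_power2 by (simp add: cross_def inner_complex_def power2_eq_square algebra_simps)

lemma rhombus_sides_cross_ne_0:
  assumes "rhombus_sides s \<theta> u v" "0 < \<theta>" "\<theta> < pi"
  shows "cross u v \<noteq> 0"
proof
  assume "cross u v = 0"
  note R = rhombus_sides_inner[OF assms(1)]
  have "(s * s * sin \<theta>)\<^sup>2 = (s * s)\<^sup>2 * (1 - (cos \<theta>)\<^sup>2)"
      unfolding power_mult_distrib[of "s * s"] sin_squared_eq ..
  also have "\<dots> = 0"
    using \<open>cross u v = 0\<close> cross_squared[of u v] unfolding R by (simp add: power2_eq_square algebra_simps)
  finally have "sin \<theta> = 0" using R(1) by simp
  then show False using sin_gt_zero[OF assms(2,3)] by simp
qed

text \<open>
  Both parallelograms have the same four corners, hence the same centre, and opposite corners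
  are symmetric about it; so they have the same pairs of opposite corners.
\<close>

lemma parallelogram_eq_diagonals:
  assumes uv: "cross u v \<noteq> 0" and ab: "cross a b \<noteq> 0" and eq: "parallelogram p u v = parallelogram q a b"
  shows "{p, p + u + v} = {q, q + a + b} \<and> {p + u, p + v} = {q + a, q + b} \<or>
    {p, p + u + v} = {q + a, q + b} \<and> {p + u, p + v} = {q, q + a + b}"
proof -
  have dist: "u \<noteq> 0" "v \<noteq> 0" "u \<noteq> v" "u + v \<noteq> 0" if "cross u v \<noteq> 0" for u v
    using that by (auto simp: cross_def algebra_simps add_eq_0_iff)
  have sets: "{p, p + u, p + v, p + u + v} = {q, q + a, q + b, q + a + b}"
    using extreme_points_parallelogram[OF uv, of _ p] extreme_points_parallelogram[OF ab, of _ q]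
        unfolding eq by blast
  have sum: "\<Sum>{p, p + u, p + v, p + u + v} = 2 * (p + (p + u + v))" if "cross u v \<noteq> 0" for p u v
    using dist[OF that] by (simp add: add.assoc eq_commute[of 0])
  have opp: "p + (p + u + v) = q + (q + a + b)"
  proof -
    have "2 * (p + (p + u + v)) = 2 * (q + (q + a + b))"
      unfolding sum[OF uv, of p, symmetric] sum[OF ab, of q, symmetric] sets ..
    then show ?thesis by (simp only: mult_cancel_left) simp
  qed
  have opp': "p + (p + u + v) = (q + a) + (q + b)" "(p + u) + (p + v) = q + (q + a + b)"
    "(p + u) + (p + v) = (q + a) + (q + b)"
    using opp by (simp_all add: algebra_simps)
  have pair: "{x, x'} = {y, y'}" if "x + x' = y + y'" "x \<in> {y, y'}" for x x' y y' :: complex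
    using that by (auto simp: add.commute)
  have mem: "p \<in> {q, q + a, q + b, q + a + b}" "p + u \<in> {q, q + a, q + b, q + a + b}"
    unfolding sets[symmetric] by simp_all
  have other: "p + u \<notin> {p, p + u + v}" using dist[OF uv] by simp
  show ?thesis
  proof (cases "p \<in> {q, q + a + b}")
    case True
    from pair[OF opp this] have 1: "{p, p + u + v} = {q, q + a + b}" .
    then have "p + u \<in> {q + a, q + b}" using mem(2) other by blast
    from pair[OF opp'(3) this] 1 show ?thesis by blast
  next
    case False
    then have "p \<in> {q + a, q + b}" using mem(1) by blast
    from pair[OF opp'(1) this] have 1: "{p, p + u + v} = {q + a, q + b}" .
    then have "p + u \<in> {q, q + a + b}" using mem(2) other by blast
    from pair[OF opp'(2) this] 1 show ?thesis by blast
  qed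
qed

lemma doubleton_dist: "{w, x} = {y, z} \<Longrightarrow> dist w x = dist y z"
  by (auto simp: doubleton_eq_iff dist_commute)

lemma doubleton_mult: "{w, x} = {y, z} \<Longrightarrow> F w * F x = F y * (F z :: int)"
  by (auto simp: doubleton_eq_iff)

text \<open>
  A tile may be presented with any of its corners first, but comparing the lengths of the
  diagonals determines the angle between the side vectors \<open>zeta ^ r\<close>, \<open>zeta ^ s\<close>. Since the
  cosine of that angle is that of 72 or of 144 degrees, the corners \<open>q\<close> and
  \<open>q + zeta ^ r + zeta ^ s\<close> are the 72 degree corners of a thick tile or the 144 degree corners
  of a thin one.
\<close>

lemma diamond_products:
  fixes F :: "complex \<Rightarrow> int"
  assumes rs: "r < 5" "s < 5" "r \<noteq> s" and eq: "parallelogram p u v = zeta_tile q r s"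
    and F: "F (q + zeta ^ r) * F (q + zeta ^ s) - F q * F (q + zeta ^ r + zeta ^ s) = 1"
  shows "thick_sides \<sigma> u v \<Longrightarrow> F (p + u) * F (p + v) - F p * F (p + u + v) = 1"
    and "thin_sides \<sigma> u v \<Longrightarrow> F p * F (p + u + v) - F (p + u) * F (p + v) = 1"
proof -
  let ?a = "zeta ^ r" and ?b = "zeta ^ s" and ?c = "cos (2 * pi / 5)"
  have norms: "(norm (?a + ?b))\<^sup>2 = 2 + 2 * inner ?a ?b" "(norm (?a - ?b))\<^sup>2 = 2 - 2 * inner ?a ?b"
  proof -
    have "inner ?a ?a = 1" "inner ?b ?b = 1" using norm_zeta_power norm_eq_1 by blast+
    then show "(norm (?a + ?b))\<^sup>2 = 2 + 2 * inner ?a ?b" "(norm (?a - ?b))\<^sup>2 = 2 - 2 * inner ?a ?b"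
      unfolding power2_norm_eq_inner
          by (simp_all add: inner_add_left inner_add_right inner_diff_left inner_diff_right inner_commute)
  qed
  have 1: "F p * F (p + u + v) = F q * F (q + ?a + ?b) \<and> F (p + u) * F (p + v) = F (q + ?a) * F (q + ?b)
      \<and> inner ?a ?b = cos \<theta> \<or>
    F p * F (p + u + v) = F (q + ?a) * F (q + ?b) \<and> F (p + u) * F (p + v) = F q * F (q + ?a + ?b)
      \<and> inner ?a ?b = - cos \<theta>"
    if R: "rhombus_sides \<sigma> \<theta> u v" and \<theta>: "0 < \<theta>" "\<theta> < pi" for \<theta>
  proof -
    note I = rhombus_sides_inner[OF R]
    have uv: "(norm (u + v))\<^sup>2 = 2 * \<sigma>\<^sup>2 + 2 * \<sigma>\<^sup>2 * cos \<theta>" "(norm (u - v))\<^sup>2 = 2 * \<sigma>\<^sup>2 - 2 * \<sigma>\<^sup>2 * cos \<theta>"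
    proof -
      have "inner u u = \<sigma>\<^sup>2" "inner v v = \<sigma>\<^sup>2"
          using I(2,3) power2_norm_eq_inner[of u] power2_norm_eq_inner[of v] by simp_all
      then show "(norm (u + v))\<^sup>2 = 2 * \<sigma>\<^sup>2 + 2 * \<sigma>\<^sup>2 * cos \<theta>"
          "(norm (u - v))\<^sup>2 = 2 * \<sigma>\<^sup>2 - 2 * \<sigma>\<^sup>2 * cos \<theta>"
        unfolding power2_norm_eq_inner
        by (simp_all add: inner_add_left inner_add_right inner_diff_left inner_diff_right inner_commute
            I(4) inner_commute[of v u])
    qed
    have d: "norm (u + v) = dist p (p + u + v)" "norm (u - v) = dist (p + u) (p + v)"
      "norm (?a + ?b) = dist q (q + ?a + ?b)" "norm (?a - ?b) = dist (q + ?a) (q + ?b)"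
      by (simp_all add: dist_norm add.assoc norm_minus_commute add.commute)
    consider (same) "{p, p + u + v} = {q, q + ?a + ?b}" "{p + u, p + v} = {q + ?a, q + ?b}"
      | (swap) "{p, p + u + v} = {q + ?a, q + ?b}" "{p + u, p + v} = {q, q + ?a + ?b}"
      using parallelogram_eq_diagonals[OF rhombus_sides_cross_ne_0[OF R \<theta>] cross_zeta_ne_0[OF rs] eq]
          by blast
    then show ?thesis
    proof cases
      case same
      have "norm (u + v) = norm (?a + ?b)" "norm (u - v) = norm (?a - ?b)"
        unfolding d using doubleton_dist[OF same(1)] doubleton_dist[OF same(2)] by blast+
      then have e: "2 * \<sigma>\<^sup>2 + 2 * \<sigma>\<^sup>2 * cos \<theta> = 2 + 2 * inner ?a ?b"
          "2 * \<sigma>\<^sup>2 - 2 * \<sigma>\<^sup>2 * cos \<theta> = 2 - 2 * inner ?a ?b"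
        using uv norms by simp_all
      then have "\<sigma>\<^sup>2 = 1" by linarith
      then have "inner ?a ?b = cos \<theta>" using e(1) by simp
      moreover have "F p * F (p + u + v) = F q * F (q + ?a + ?b)"
          "F (p + u) * F (p + v) = F (q + ?a) * F (q + ?b)"
        using doubleton_mult[OF same(1), of F] doubleton_mult[OF same(2), of F] by blast+
      ultimately show ?thesis by blast
    next
      case swap
      have "norm (u + v) = norm (?a - ?b)" "norm (u - v) = norm (?a + ?b)"
        unfolding d using doubleton_dist[OF swap(1)] doubleton_dist[OF swap(2)] by blast+
      then have e: "2 * \<sigma>\<^sup>2 + 2 * \<sigma>\<^sup>2 * cos \<theta> = 2 - 2 * inner ?a ?b"
          "2 * \<sigma>\<^sup>2 - 2 * \<sigma>\<^sup>2 * cos \<theta> = 2 + 2 * inner ?a ?b"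
        using uv norms by simp_all
      then have "\<sigma>\<^sup>2 = 1" by linarith
      then have "inner ?a ?b = - cos \<theta>" using e(1) by simp
      moreover have "F p * F (p + u + v) = F (q + ?a) * F (q + ?b)"
          "F (p + u) * F (p + v) = F q * F (q + ?a + ?b)"
        using doubleton_mult[OF swap(1), of F] doubleton_mult[OF swap(2), of F] by blast+
      ultimately show ?thesis by blast
    qed
  qed
  have c: "0 < ?c" using cos72_bounds by simp
  have c36: "?c < cos (pi / 5)" by (rule cos_monotone_0_pi) (auto simp: field_simps)
  have ab: "inner ?a ?b = ?c \<or> inner ?a ?b = - ?c - 1 / 2" using inner_zeta_powers[OF rs] by simp
  show "F (p + u) * F (p + v) - F p * F (p + u + v) = 1" if "thick_sides \<sigma> u v"
  proof -
    have "inner ?a ?b \<noteq> - ?c" using ab c by auto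
    then show ?thesis using 1[OF that] F by (auto simp: field_simps)
  qed
  show "F p * F (p + u + v) - F (p + u) * F (p + v) = 1" if "thin_sides \<sigma> u v"
  proof -
    have "inner ?a ?b \<noteq> cos (pi / 5)" using ab c c36 by auto
    then show ?thesis using 1[OF that] F by (auto simp: field_simps)
  qed
qed

text \<open>
  A map that scales all distances by \<open>c\<close> and fixes the origin is linear and scales inner
  products by \<open>c\<^sup>2\<close>.
\<close>

lemma similarityE:
  fixes g :: "complex \<Rightarrow> complex"
  assumes "similarity g"
  obtains c L where "0 < c" "linear L" "inj L" "surj L" "\<And>z. g z = g 0 + L z"
      "\<And>u v. inner (L u) (L v) = c\<^sup>2 * inner u v"
proof -
  obtain c where c: "0 < c" "\<And>x y. dist (g x) (g y) = c * dist x y"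
    using assms by (auto simp: similarity_def)
  define L where "L = (\<lambda>z. g z - g 0)"
  have lin: "linear L"
    by (rule scaling_linear[where c = c]) (use c in \<open>simp_all add: L_def dist_norm\<close>)
  have norm: "norm (L u) = c * norm u" for u using c(2)[of u 0] by (simp add: L_def dist_norm)
  have inner: "inner (L u) (L v) = c\<^sup>2 * inner u v" for u v
    unfolding dot_norm linear_add[OF lin, symmetric] norm
        by (simp add: power_mult_distrib algebra_simps diff_divide_distrib)
  have inj: "inj L"
    unfolding linear_injective_0[OF lin]
  proof (intro allI impI)
    fix x assume "L x = 0"
    then show "x = 0" using norm[of x] c(1) by simp
  qed
  have surj: "surj L" using lin inj by (rule linear_injective_imp_surjective) simp
  show thesis by (rule that[OF c(1) lin inj surj _ inner]) (simp add: L_def)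
qed

lemma rhombus_sides_linear_image:
  assumes "0 < c" "\<And>u v. inner (L u) (L v) = c\<^sup>2 * inner u v" "rhombus_sides s \<theta> (L u) (L v)"
  shows "rhombus_sides (s / c) \<theta> u v"
proof -
  have norm: "norm (L u) = c * norm u" for u
    using assms(1,2) by (simp add: norm_eq_sqrt_inner real_sqrt_mult)
  show ?thesis using assms by (auto simp: rhombus_sides_def vec_angle_def norm power2_eq_square)
qed

theorem corollary2p2:
  fixes \<T> :: "complex set set"
  assumes "penrose_rhombic_tiling \<T>"
  shows "infinite {f. frieze_pattern \<T> f \<and> card (f ` tiling_vertices \<T>) = 4}"
proof -
  obtain g \<U> where g: "similarity g" and \<U>: "unit_penrose_tiling \<U>" and \<T>: "\<T> = (\<lambda>T. g ` T) ` \<U>"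
    using assms by (auto simp: penrose_rhombic_tiling_def)
  obtain c L where c: "0 < c" and L: "linear L" "inj L" "surj L" and gL: "\<And>z. g z = g 0 + L z"
    and inner: "\<And>u v. inner (L u) (L v) = c\<^sup>2 * inner u v"
    using similarityE[OF g] by blast
  have "inj g" using L(2) gL by (metis (mono_tags, lifting) add_left_cancel injD injI)
  have "surj g"
    unfolding surj_def
  proof
    fix y
    obtain x where "y - g 0 = L x" using L(3) by (rule surjE)
    then show "\<exists>x. y = g x" using gL[of x] by (intro exI[of _ x]) (simp add: algebra_simps)
  qed
  have gS: "g ` S = (+) (g 0) ` L ` S" for S
    unfolding image_image by (rule image_cong[OF refl gL])
  have g_par: "g ` parallelogram p u v = parallelogram (g p) (L u) (L v)" for p u v
  proof -
    have "L ` parallelogram p u v = parallelogram (L p) (L u) (L v)"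
      unfolding parallelogram_def convex_hull_linear_image[OF L(1)] by (simp add: linear_add[OF L(1)])
    then show ?thesis unfolding gS by (simp only: translate_parallelogram gL[of p])
  qed
  have g_add: "g (p + u) = g p + L u" for p u
    using gL[of p] gL[of "p + u"] by (simp add: linear_add[OF L(1)] add.assoc)
  have g_ext: "g x extreme_point_of g ` S \<longleftrightarrow> x extreme_point_of S" for x S
  proof -
    have "L ` {x} face_of L ` S \<longleftrightarrow> {x} face_of S" by (rule face_of_linear_image[OF L(1,2)])
    then show ?thesis
      unfolding gS by (simp add: extreme_point_of_translation_eq gL[of x] face_of_singleton)
  qed
  have V: "tiling_vertices \<T> = g ` tiling_vertices \<U>"
  proof (intro equalityI subsetI)
    fix y assume "y \<in> tiling_vertices \<T>"
    then obtain T where "T \<in> \<U>" "y extreme_point_of g ` T" by (auto simp: tiling_vertices_def \<T>)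
    moreover obtain x where "y = g x" using \<open>surj g\<close> by (rule surjE)
    ultimately show "y \<in> g ` tiling_vertices \<U>" by (auto simp: tiling_vertices_def g_ext)
  next
    fix y assume "y \<in> g ` tiling_vertices \<U>"
    then show "y \<in> tiling_vertices \<T>" by (auto simp: tiling_vertices_def g_ext \<T>)
  qed
  obtain \<iota> :: "complex \<Rightarrow> int" where
    \<iota>: "\<forall>T\<in>\<U>. \<exists>q r s. r < 5 \<and> s < 5 \<and> r \<noteq> s \<and> T = zeta_tile q r s \<and>
      \<iota> q \<in> {1, 2} \<and> \<iota> (q + zeta ^ r) = \<iota> q + 1 \<and> \<iota> (q + zeta ^ s) = \<iota> q + 1 \<and>
      \<iota> (q + zeta ^ r + zeta ^ s) = \<iota> q + 2"
    and \<iota>_image: "\<iota> ` tiling_vertices \<U> = {1, 2, 3, 4}"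
    using penrose_vertex_index[OF \<U>] by blast
  define f where "f = (\<lambda>(k::nat) w. if w \<in> tiling_vertices \<T> then int k + \<iota> (inv g w) else undefined)"
  have f_g: "f k (g x) = int k + \<iota> x" if "x \<in> tiling_vertices \<U>" for k x
    using that \<open>inj g\<close> by (simp add: f_def V)
  have image: "f k ` tiling_vertices \<T> = (+) (int k) ` {1, 2, 3, 4}" for k
    unfolding V \<iota>_image[symmetric] image_image by (rule image_cong[OF refl f_g])
  have frieze: "frieze_pattern \<T> (f k)" for k
  proof -
    have "f k w \<in> {0<..}" if "w \<in> tiling_vertices \<T>" for w
    proof -
      have "f k w \<in> (+) (int k) ` {1, 2, 3, 4}" unfolding image[symmetric] using that by (rule imageI)
      then show ?thesis by auto
    qed
    then have "f k \<in> tiling_vertices \<T> \<rightarrow>\<^sub>E {0<..}" by (auto simp: f_def)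
    moreover have "(thick_sides s u v \<longrightarrow> f k (p + u) * f k (p + v) - f k p * f k (p + u + v) = 1) \<and>
        (thin_sides s u v \<longrightarrow> f k p * f k (p + u + v) - f k (p + u) * f k (p + v) = 1)"
      if tile: "parallelogram p u v \<in> \<T>" for s p u v
    proof -
      obtain p' u' v' where p': "p = g p'" "u = L u'" "v = L v'"
        using \<open>surj g\<close> L(3) unfolding surj_def by blast
      obtain T where T: "T \<in> \<U>" "g ` parallelogram p' u' v' = g ` T"
        using tile unfolding p' g_par[symmetric] \<T> by blast
      then have TU: "parallelogram p' u' v' \<in> \<U>" using \<open>inj g\<close> by (simp add: inj_image_eq_iff)
      define F where "F = (\<lambda>x. int k + \<iota> x)"
      from \<iota> TU obtain q r t where q: "r < 5" "t < 5" "r \<noteq> t"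
        "parallelogram p' u' v' = zeta_tile q r t"
        "\<iota> (q + zeta ^ r) = \<iota> q + 1" "\<iota> (q + zeta ^ t) = \<iota> q + 1" "\<iota> (q + zeta ^ r + zeta ^ t) = \<iota> q + 2"
        by blast
      have F: "F (q + zeta ^ r) * F (q + zeta ^ t) - F q * F (q + zeta ^ r + zeta ^ t) = 1"
        unfolding F_def q(5-7) by (simp add: algebra_simps)
      have vals: "f k p = F p'" "f k (p + u) = F (p' + u')" "f k (p + v) = F (p' + v')"
          "f k (p + u + v) = F (p' + u' + v')"
        if "cross u' v' \<noteq> 0"
      proof -
        have "x \<in> tiling_vertices \<U>" if "x \<in> {p', p' + u', p' + v', p' + u' + v'}" for x
          unfolding tiling_vertices_def
          using TU that extreme_points_parallelogram[OF \<open>cross u' v' \<noteq> 0\<close>, of x p'] by blast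
        then show "f k p = F p'" "f k (p + u) = F (p' + u')" "f k (p + v) = F (p' + v')"
            "f k (p + u + v) = F (p' + u' + v')"
          unfolding F_def p' g_add[symmetric] by (simp_all add: f_g)
      qed
      have sides: "rhombus_sides (s / c) \<theta> u' v'" if "rhombus_sides s \<theta> u v" for \<theta>
        using rhombus_sides_linear_image[OF c inner] that unfolding p' by blast
      have "f k (p + u) * f k (p + v) - f k p * f k (p + u + v) = 1" if thick: "thick_sides s u v"
        using diamond_products(1)[where F = F, OF q(1-4) F sides[OF thick]] vals
            rhombus_sides_cross_ne_0[OF sides[OF thick]] by simp
      moreover have "f k p * f k (p + u + v) - f k (p + u) * f k (p + v) = 1" if thin: "thin_sides s u v"
        using diamond_products(2)[where F = F, OF q(1-4) F sides[OF thin]] vals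
            rhombus_sides_cross_ne_0[OF sides[OF thin]] by simp
      ultimately show ?thesis by blast
    qed
    ultimately show ?thesis unfolding frieze_pattern_def by blast
  qed
  have card: "card (f k ` tiling_vertices \<T>) = 4" for k
    unfolding image by (simp add: card_image)
  have "inj f"
  proof (rule injI)
    fix k l assume "f k = f l"
    have "tiling_vertices \<U> \<noteq> {}" using \<iota>_image by auto
    then obtain x where x: "x \<in> tiling_vertices \<U>" by blast
    have "f k (g x) = f l (g x)" using \<open>f k = f l\<close> by simp
    then have "int k + \<iota> x = int l + \<iota> x" unfolding f_g[OF x] .
    then show "k = l" by simp
  qed
  then have "infinite (range f)" by (rule range_inj_infinite)
  moreover have "range f \<subseteq> {f. frieze_pattern \<T> f \<and> card (f ` tiling_vertices \<T>) = 4}"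
    using frieze card by auto
  ultimately show ?thesis by (rule infinite_super[rotated])
qed

end
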